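(* Let $R$ be a chain ring, $Z$ its set of zerodivisors and $N$ its nilradical. The following conditions are equivalent: (1) $R$ is almost maximal and $Z=N$; (2) each ideal of $R$ is quasi-projective.
   Context: All rings are commutative with unity. A chain ring (valuation ring) is a ring whose ideals are totally ordered by inclusion. The set $Z$ of zerodivisors includes $0$. An $R$-module $V$ is quasi-projective if the natural homomorphism $\mathrm{Hom}_R(V,V)\rightarrow\mathrm{Hom}_R(V,V/X)$ is surjective for every submodule $X$ of $V$. An $R$-module $M$ is linearly compact if every finitely solvable set of congruences $x\equiv x_\alpha\ (\mathrm{mod}\ M_\alpha)$ ($\alpha\in\Lambda$, $x_\alpha\in M$, $M_\alpha$ a submodule of $M$ for each $\alpha\in\Lambda$) has a simultaneous solution in $M$. A chain ring $R$ is maximal if it is linearly compact over itself, and almost maximal if $R/A$ is maximal for each non-zero ideal $A$. *)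

theory Defs
  imports "HOL-Algebra.QuotRing" "HOL-Algebra.Module"
begin

text \<open>As in HOL-Algebra, \<open>cring\<close> admits the zero ring, and it counts as a chain ring here.\<close>

locale chain_ring = cring R for R (structure) +
  assumes ideals_total: "\<lbrakk>ideal I R; ideal J R\<rbrakk> \<Longrightarrow> I \<subseteq> J \<or> J \<subseteq> I"

definition zerodivisors :: "('a, 'm) ring_scheme \<Rightarrow> 'a set" where
  "zerodivisors R =
     {a \<in> carrier R. a = \<zero>\<^bsub>R\<^esub> \<or> (\<exists>b \<in> carrier R. b \<noteq> \<zero>\<^bsub>R\<^esub> \<and> a \<otimes>\<^bsub>R\<^esub> b = \<zero>\<^bsub>R\<^esub>)}"

definition nilradical :: "('a, 'm) ring_scheme \<Rightarrow> 'a set" where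
  "nilradical R = {a \<in> carrier R. \<exists>n::nat. a [^]\<^bsub>R\<^esub> n = \<zero>\<^bsub>R\<^esub>}"

definition regular_module :: "('a, 'm) ring_scheme \<Rightarrow> ('a, 'a) module" where
  "regular_module R =
     \<lparr>carrier = carrier R, monoid.mult = monoid.mult R, one = one R,
      ring.zero = ring.zero R, add = add R, smult = monoid.mult R\<rparr>"

text \<open>The library's module record extends the ring record; a module does not use the fields
  \<open>mult\<close> and \<open>one\<close>, so their values in the next two definitions are irrelevant.\<close>

definition ideal_module :: "('a, 'm) ring_scheme \<Rightarrow> 'a set \<Rightarrow> ('a, 'a) module" where
  "ideal_module R I = (regular_module R)\<lparr>carrier := I\<rparr>"

definition quotient_module ::
    "('r, 'a, 'm) module_scheme \<Rightarrow> 'a set \<Rightarrow> ('r, 'a set) module" where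
  "quotient_module M X =
     \<lparr>carrier = a_rcosets\<^bsub>M\<^esub> X, monoid.mult = undefined, one = undefined,
      ring.zero = X, add = set_add M, smult = (\<lambda>a C. \<Union>v \<in> C. X +>\<^bsub>M\<^esub> (a \<odot>\<^bsub>M\<^esub> v))\<rparr>"

text \<open>Homomorphisms are taken to be \<open>undefined\<close> outside the carrier, so that equality of functions
  is equality of homomorphisms and \<open>module_hom\<close> is really the set Hom.\<close>

definition module_hom ::
    "('r, 'k) ring_scheme \<Rightarrow> ('r, 'a, 'm) module_scheme \<Rightarrow> ('r, 'b, 'n) module_scheme
      \<Rightarrow> ('a \<Rightarrow> 'b) set" where
  "module_hom R M N =
     {h \<in> carrier M \<rightarrow>\<^sub>E carrier N.
        (\<forall>x \<in> carrier M. \<forall>y \<in> carrier M. h (x \<oplus>\<^bsub>M\<^esub> y) = h x \<oplus>\<^bsub>N\<^esub> h y) \<and>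
        (\<forall>a \<in> carrier R. \<forall>x \<in> carrier M. h (a \<odot>\<^bsub>M\<^esub> x) = a \<odot>\<^bsub>N\<^esub> h x)}"

definition quasi_projective ::
    "('r, 'k) ring_scheme \<Rightarrow> ('r, 'a, 'm) module_scheme \<Rightarrow> bool" where
  "quasi_projective R V \<longleftrightarrow>
     (\<forall>X. submodule X R V \<longrightarrow>
        (\<lambda>f. compose (carrier V) (\<lambda>v. X +>\<^bsub>V\<^esub> v) f) ` module_hom R V V
          = module_hom R V (quotient_module V X))"

text \<open>A pair \<open>(x, H)\<close> stands for the congruence with unknown \<open>y\<close> that \<open>y\<close> is congruent to \<open>x\<close>
  modulo \<open>H\<close>. A system of congruences is a set of such pairs; repetitions in an indexed family
  do not affect solvability.\<close>

definition solves_congruences ::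
    "('r, 'a, 'm) module_scheme \<Rightarrow> 'a \<Rightarrow> ('a \<times> 'a set) set \<Rightarrow> bool" where
  "solves_congruences M y C \<longleftrightarrow> y \<in> carrier M \<and> (\<forall>(x, H) \<in> C. y \<ominus>\<^bsub>M\<^esub> x \<in> H)"

definition linearly_compact ::
    "('r, 'k) ring_scheme \<Rightarrow> ('r, 'a, 'm) module_scheme \<Rightarrow> bool" where
  "linearly_compact R M \<longleftrightarrow>
     (\<forall>C. (\<forall>(x, H) \<in> C. x \<in> carrier M \<and> submodule H R M) \<longrightarrow>
          (\<forall>F. finite F \<and> F \<subseteq> C \<longrightarrow> (\<exists>y. solves_congruences M y F)) \<longrightarrow>
          (\<exists>y. solves_congruences M y C))"

definition maximal_ring :: "('a, 'm) ring_scheme \<Rightarrow> bool" where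
  "maximal_ring R \<longleftrightarrow> linearly_compact R (regular_module R)"

definition almost_maximal_ring :: "('a, 'm) ring_scheme \<Rightarrow> bool" where
  "almost_maximal_ring R \<longleftrightarrow>
     (\<forall>A. ideal A R \<and> A \<noteq> {\<zero>\<^bsub>R\<^esub>} \<longrightarrow> maximal_ring (R Quot A))"

lemma (in cring) module_regular_module: "module R (regular_module R)"
proof (rule moduleI)
  show "cring R" by (rule is_cring)
  show "abelian_group (regular_module R)"
    by (rule abelian_groupI)
       (auto simp: regular_module_def a_ac intro: l_neg)
qed (auto simp: regular_module_def l_distr r_distr m_assoc)

lemma (in cring) submodule_regular_module_iff_ideal:
  "submodule I R (regular_module R) \<longleftrightarrow> ideal I R"
proof
  interpret RM: module R "regular_module R" by (rule module_regular_module)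
  have inv: "a_inv (regular_module R) = a_inv R"
    by (simp add: fun_eq_iff a_inv_def m_inv_def regular_module_def)
  {
    assume "submodule I R (regular_module R)"
    note E = RM.submoduleE[OF this, unfolded inv]
    have sub: "I \<subseteq> carrier R" and ne: "I \<noteq> {}"
      and add: "\<And>a b. \<lbrakk>a \<in> I; b \<in> I\<rbrakk> \<Longrightarrow> a \<oplus> b \<in> I"
      and mult: "\<And>a b. \<lbrakk>a \<in> carrier R; b \<in> I\<rbrakk> \<Longrightarrow> a \<otimes> b \<in> I"
      and neg: "\<And>a. a \<in> I \<Longrightarrow> \<ominus> a \<in> I"
      using E by (auto simp: regular_module_def)
    show "ideal I R"
    proof (rule idealI)
      show "ring R" by (rule ring_axioms)
      show "subgroup I (add_monoid R)"
        using sub ne add neg by (intro add.subgroupI) auto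
      show "x \<otimes> a \<in> I" if "a \<in> I" "x \<in> carrier R" for a x
        using mult that by simp
      show "a \<otimes> x \<in> I" if "a \<in> I" "x \<in> carrier R" for a x
        using mult[of x a] that sub by (auto simp: m_comm subset_iff)
    qed
  }
  {
    assume "ideal I R"
    then interpret I: ideal I R .
    show "submodule I R (regular_module R)"
      by (rule RM.submoduleI, unfold inv)
         (auto simp: regular_module_def I.I_l_closed)
  }
qed

lemma (in cring) module_ideal_module: "ideal I R \<Longrightarrow> module R (ideal_module R I)"
  unfolding ideal_module_def
  using submodule.submodule_is_module module_regular_module submodule_regular_module_iff_ideal
  by blast

lemma (in module) submodule_abelian_subgroup:
  assumes "submodule X R M"
  shows "abelian_subgroup X M"
  using assms
  by (intro abelian_subgroupI3) (auto simp: additive_subgroup_def submodule_def M.abelian_group_axioms)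

lemma (in module) quotient_smult:
  assumes X: "submodule X R M" and a: "a \<in> carrier R" and v: "v \<in> carrier M"
  shows "a \<odot>\<^bsub>quotient_module M X\<^esub> (X +>\<^bsub>M\<^esub> v) = X +>\<^bsub>M\<^esub> (a \<odot>\<^bsub>M\<^esub> v)"
proof -
  interpret S: abelian_subgroup X M
    by (rule submodule_abelian_subgroup[OF X])
  note XE = submoduleE[OF X]
  have "X +>\<^bsub>M\<^esub> (a \<odot>\<^bsub>M\<^esub> w) = X +>\<^bsub>M\<^esub> (a \<odot>\<^bsub>M\<^esub> v)" if w: "w \<in> X +>\<^bsub>M\<^esub> v" for w
  proof -
    obtain h where h: "h \<in> X" "w = h \<oplus>\<^bsub>M\<^esub> v"
      using w by (auto simp: a_r_coset_def')
    have hc: "h \<in> carrier M" using h XE(1) by auto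
    have "a \<odot>\<^bsub>M\<^esub> w = a \<odot>\<^bsub>M\<^esub> h \<oplus>\<^bsub>M\<^esub> a \<odot>\<^bsub>M\<^esub> v"
      using h hc a v by (simp add: smult_r_distr)
    then have "a \<odot>\<^bsub>M\<^esub> w \<in> X +>\<^bsub>M\<^esub> (a \<odot>\<^bsub>M\<^esub> v)"
      using XE(4)[OF a h(1)] by (auto simp: a_r_coset_def')
    then show ?thesis
      by (rule S.a_repr_independence'[OF _ smult_closed[OF a v], symmetric])
  qed
  moreover have "v \<in> X +>\<^bsub>M\<^esub> v"
    using S.a_rcos_self[OF v] .
  ultimately have "(\<Union>w \<in> X +>\<^bsub>M\<^esub> v. X +>\<^bsub>M\<^esub> (a \<odot>\<^bsub>M\<^esub> w)) = X +>\<^bsub>M\<^esub> (a \<odot>\<^bsub>M\<^esub> v)"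
    by blast
  then show ?thesis
    by (simp add: quotient_module_def)
qed

lemma (in module) module_quotient_module:
  assumes X: "submodule X R M"
  shows "module R (quotient_module M X)"
proof -
  let ?Q = "quotient_module M X"
  interpret S: abelian_subgroup X M
    by (rule submodule_abelian_subgroup[OF X])
  have car: "C \<in> carrier ?Q \<longleftrightarrow> (\<exists>v \<in> carrier M. C = X +>\<^bsub>M\<^esub> v)" for C
    by (auto simp: quotient_module_def A_RCOSETS_def')
  have add: "(X +>\<^bsub>M\<^esub> v) \<oplus>\<^bsub>?Q\<^esub> (X +>\<^bsub>M\<^esub> w) = X +>\<^bsub>M\<^esub> (v \<oplus>\<^bsub>M\<^esub> w)"
    if "v \<in> carrier M" "w \<in> carrier M" for v w
    using S.a_rcos_sum[OF that] by (simp add: quotient_module_def)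
  have z: "\<zero>\<^bsub>?Q\<^esub> = X +>\<^bsub>M\<^esub> \<zero>\<^bsub>M\<^esub>"
    by (simp add: quotient_module_def S.a_rcos_const[OF S.zero_closed])
  have ag: "abelian_group ?Q"
  proof (rule abelian_groupI)
    fix x assume "x \<in> carrier ?Q"
    then obtain v where v: "v \<in> carrier M" "x = X +>\<^bsub>M\<^esub> v" by (auto simp: car)
    then have "(X +>\<^bsub>M\<^esub> (\<ominus>\<^bsub>M\<^esub> v)) \<oplus>\<^bsub>?Q\<^esub> x = \<zero>\<^bsub>?Q\<^esub>"
      by (simp add: add z M.l_neg)
    moreover have "X +>\<^bsub>M\<^esub> (\<ominus>\<^bsub>M\<^esub> v) \<in> carrier ?Q"
      using v by (auto simp: car)
    ultimately show "\<exists>y\<in>carrier ?Q. y \<oplus>\<^bsub>?Q\<^esub> x = \<zero>\<^bsub>?Q\<^esub>" by blast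
  next
    show "\<zero>\<^bsub>?Q\<^esub> \<in> carrier ?Q" unfolding z by (auto simp: car)
  next
    fix x y assume "x \<in> carrier ?Q" "y \<in> carrier ?Q"
    then obtain v w where vw: "v \<in> carrier M" "w \<in> carrier M" "x = X +>\<^bsub>M\<^esub> v" "y = X +>\<^bsub>M\<^esub> w"
      by (auto simp: car)
    then show "x \<oplus>\<^bsub>?Q\<^esub> y \<in> carrier ?Q" by (auto simp: car add)
    from vw show "x \<oplus>\<^bsub>?Q\<^esub> y = y \<oplus>\<^bsub>?Q\<^esub> x"
      by (simp only: add M.a_comm)
    fix u assume "u \<in> carrier ?Q"
    then obtain t where "t \<in> carrier M" "u = X +>\<^bsub>M\<^esub> t" by (auto simp: car)
    with vw show "(x \<oplus>\<^bsub>?Q\<^esub> y) \<oplus>\<^bsub>?Q\<^esub> u = x \<oplus>\<^bsub>?Q\<^esub> (y \<oplus>\<^bsub>?Q\<^esub> u)"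
      by (simp only: add M.a_assoc M.a_closed)
  next
    fix x assume "x \<in> carrier ?Q"
    then obtain v where "v \<in> carrier M" "x = X +>\<^bsub>M\<^esub> v" by (auto simp: car)
    then show "\<zero>\<^bsub>?Q\<^esub> \<oplus>\<^bsub>?Q\<^esub> x = x"
      by (simp only: z add M.zero_closed M.l_zero)
  qed
  note sm = quotient_smult[OF X]
  show ?thesis
  proof (rule moduleI[OF R.is_cring ag])
    fix a x assume "a \<in> carrier R" "x \<in> carrier ?Q"
    then show "a \<odot>\<^bsub>?Q\<^esub> x \<in> carrier ?Q" by (auto simp: car sm)
  next
    fix a b x assume "a \<in> carrier R" "b \<in> carrier R" "x \<in> carrier ?Q"
    then show "(a \<oplus> b) \<odot>\<^bsub>?Q\<^esub> x = a \<odot>\<^bsub>?Q\<^esub> x \<oplus>\<^bsub>?Q\<^esub> b \<odot>\<^bsub>?Q\<^esub> x"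
      by (auto simp: car sm add smult_l_distr)
  next
    fix a x y assume "a \<in> carrier R" "x \<in> carrier ?Q" "y \<in> carrier ?Q"
    then show "a \<odot>\<^bsub>?Q\<^esub> (x \<oplus>\<^bsub>?Q\<^esub> y) = a \<odot>\<^bsub>?Q\<^esub> x \<oplus>\<^bsub>?Q\<^esub> a \<odot>\<^bsub>?Q\<^esub> y"
      by (auto simp: car sm add smult_r_distr)
  next
    fix a b x assume "a \<in> carrier R" "b \<in> carrier R" "x \<in> carrier ?Q"
    then show "(a \<otimes> b) \<odot>\<^bsub>?Q\<^esub> x = a \<odot>\<^bsub>?Q\<^esub> (b \<odot>\<^bsub>?Q\<^esub> x)"
      by (auto simp: car sm smult_assoc1)
  next
    fix x assume "x \<in> carrier ?Q"
    then show "\<one> \<odot>\<^bsub>?Q\<^esub> x = x" by (auto simp: car sm)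
  qed
qed

end

theory Submission
  imports Defs
begin

text \<open>
  Write \<open>(I : t)\<close> for the ideal of all \<open>x\<close> with \<open>t x \<in> I\<close>. A homomorphism from an ideal \<open>J\<close> to
  \<open>J/X\<close> is represented by a map \<open>g\<close> from \<open>J\<close> to itself that is linear up to errors in \<open>X\<close>;
  lifting it means finding a linear map \<open>f\<close> with \<open>f x - g x \<in> X\<close> on \<open>J\<close>. Linear compactness of
  \<open>R/A\<close> is read as solvability of systems of pairwise compatible congruences in \<open>R\<close> whose moduli
  are ideals above \<open>A\<close>: the ideals form a chain, so a finite system is solvable as soon as its
  members are compatible in pairs. The two readings are \<open>quasi_projective_ideal_module_iff\<close> and
  \<open>maximal_quotient_iff\<close>.

  Suppose that all ideals are quasi-projective. If \<open>z\<close> were a zerodivisor that is not nilpotent,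
  multiplication by \<open>z\<close> would be a surjection of \<open>J = \<Inter>\<^sub>n R z\<^sup>n\<close> onto itself with
  a nonzero kernel \<open>K\<close>, namely the annihilator of \<open>z\<close>. Its inverse \<open>J \<rightarrow> J/K\<close> lifts to a
  linear section of the surjection, and a linear section \<open>f\<close> gives \<open>b = z f(b) = f(z b) = 0\<close> for
  each \<open>b \<in> K\<close>. Hence \<open>Z = N\<close>. For almost maximality, let a compatible system with values
  \<open>b\<^sub>i\<close> and moduli \<open>G\<^sub>i\<close> have no smallest modulus, and suppose that some \<open>s\<close> lies, together with
  its whole annihilator, in every \<open>G\<^sub>i\<close>. On the ideal \<open>J\<close> of the elements \<open>x\<close> with
  \<open>x G\<^sub>i \<subseteq> R s\<close> for some \<open>i\<close>, the products \<open>b\<^sub>i x\<close> fit together to a homomorphism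
  \<open>J \<rightarrow> J/Rs\<close>. A lift \<open>f\<close> of it sends \<open>s\<close> to a multiple \<open>c s\<close>, and this \<open>c\<close> is a solution
  (\<open>solvable_of_quasi_projective\<close>). A general system whose moduli have the intersection
  \<open>I \<noteq> 0\<close> need not admit such an \<open>s\<close>, but after a translation and a division by a suitable
  \<open>t \<notin> I\<close> it does: one needs \<open>s \<in> (I : t)\<close> with annihilator inside \<open>(I : t)\<close>. If \<open>t\<^sup>2 \<in> I\<close> for some
  \<open>t \<notin> I\<close>, then \<open>s = t\<close> works; otherwise \<open>I\<close> is a radical ideal and contains \<open>N = Z\<close>, so \<open>t = 1\<close>
  works with any nonzero \<open>s \<in> I\<close> (\<open>exists_element_with_small_annihilator\<close>).

  Conversely, let \<open>R\<close> be almost maximal with \<open>Z = N\<close>, and let \<open>g\<close> represent a homomorphism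
  \<open>J \<rightarrow> J/X\<close>. For \<open>X = 0\<close> it is its own lift, so let \<open>X \<noteq> 0\<close>. If each \<open>g x\<close> is a scalar
  multiple \<open>b\<^sub>x x\<close> modulo \<open>X\<close>, then the congruences
  \<open>c \<equiv> b\<^sub>x\<close> modulo \<open>(X : x)\<close> are compatible and have moduli above \<open>X\<close>, and multiplication by a
  solution \<open>c\<close> is a lift (\<open>linear_lift_of_locally_scalar\<close>). Otherwise some \<open>s = r g(s)\<close> is a proper
  multiple of its own value; morally \<open>g\<close> multiplies by \<open>1/r\<close>. Then
  \<open>J = r J\<close>, so \<open>r\<close> is not nilpotent, hence regular because \<open>Z = N\<close>, and \<open>r g\<close> is locally scalar. A
  lift of \<open>r g\<close> composed with the inverse of multiplication by \<open>r\<close> on \<open>J\<close> lifts \<open>g\<close>.\<close>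

section \<open>Congruences modulo an ideal and maximal quotients\<close>

lemma (in ideal) rcos_eq_iff:
  assumes "u \<in> carrier R" "v \<in> carrier R"
  shows "I +> u = I +> v \<longleftrightarrow> u \<ominus> v \<in> I"
  using assms quotient_eq_iff_same_a_r_cos[OF is_ideal] by auto

lemma (in ideal) rcos_minus:
  assumes "u \<in> carrier R" "v \<in> carrier R"
  shows "(I +> u) \<ominus>\<^bsub>R Quot I\<^esub> (I +> v) = I +> (u \<ominus> v)"
proof -
  interpret h: ring_hom_ring R "R Quot I" "(+>) I" by (rule rcos_ring_hom_ring)
  show ?thesis using assms by (simp add: a_minus_def)
qed

lemma regular_module_minus: "a_minus (regular_module R) = a_minus R"
  by (simp add: fun_eq_iff a_minus_def a_inv_def m_inv_def regular_module_def)

lemma (in cring) minus_eq_zero_iff: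
  assumes "x \<in> carrier R" "y \<in> carrier R"
  shows "x \<ominus> y = \<zero> \<longleftrightarrow> x = y"
proof
  assume "x \<ominus> y = \<zero>"
  moreover have "x = (x \<ominus> y) \<oplus> y" using assms by algebra
  ultimately show "x = y" using assms by simp
qed (use assms in \<open>simp add: minus_eq r_neg\<close>)

lemma (in cring) minus_mem_ideal_swap:
  assumes "ideal H R" "x \<in> carrier R" "y \<in> carrier R" "x \<ominus> y \<in> H"
  shows "y \<ominus> x \<in> H"
proof -
  have "y \<ominus> x = \<ominus> (x \<ominus> y)" using assms(2,3) by algebra
  then show ?thesis using assms
    by (metis additive_subgroup.a_inv_closed ideal.axioms(1))
qed

lemma (in cring) minus_mem_ideal_trans:
  assumes "ideal H R" "x \<in> carrier R" "y \<in> carrier R" "z \<in> carrier R"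
    and "x \<ominus> y \<in> H" "y \<ominus> z \<in> H"
  shows "x \<ominus> z \<in> H"
proof -
  have "x \<ominus> z = (x \<ominus> y) \<oplus> (y \<ominus> z)" using assms(2-4) by algebra
  then show ?thesis using assms
    by (metis additive_subgroup.a_closed ideal.axioms(1))
qed

text \<open>Two congruences with comparable moduli have a common solution if and only if their values agree
  modulo the larger modulus. In a chain ring any two moduli are comparable, so a compatible system
  is one whose members are solvable in pairs.\<close>

definition compatible_congruences ::
    "('a, 'm) ring_scheme \<Rightarrow> 'a set \<Rightarrow> ('a \<times> 'a set) set \<Rightarrow> bool" where
  "compatible_congruences R A C \<longleftrightarrow>
     (\<forall>(x, H) \<in> C. x \<in> carrier R \<and> ideal H R \<and> A \<subseteq> H \<and>
        (\<forall>(x', H') \<in> C. H \<subseteq> H' \<longrightarrow> x \<ominus>\<^bsub>R\<^esub> x' \<in> H'))"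

lemma compatible_congruencesD:
  assumes "compatible_congruences R A C" "(x, H) \<in> C"
  shows "x \<in> carrier R" "ideal H R" "A \<subseteq> H"
    and "\<And>x' H'. \<lbrakk>(x', H') \<in> C; H \<subseteq> H'\<rbrakk> \<Longrightarrow> x \<ominus>\<^bsub>R\<^esub> x' \<in> H'"
  using assms unfolding compatible_congruences_def by blast+

context chain_ring
begin

text \<open>The ideals of \<open>R/A\<close> correspond to the ideals of \<open>R\<close> above \<open>A\<close>. A finite compatible system has a
  member with smallest modulus, and the value of that member solves the system; this is where
  the total order of the ideals enters.\<close>

lemma maximal_quotient_iff:
  assumes A: "ideal A R"
  shows "maximal_ring (R Quot A) \<longleftrightarrow>
    (\<forall>C. compatible_congruences R A C \<longrightarrow> (\<exists>y \<in> carrier R. \<forall>(x, H) \<in> C. y \<ominus> x \<in> H))"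
    (is "?L \<longleftrightarrow> ?R")
proof
  interpret A: ideal A R by (rule A)
  interpret Q: cring "R Quot A" by (rule A.quotient_is_cring[OF is_cring])
  have carQ: "carrier (R Quot A) = (+>) A ` carrier R"
    by (auto simp: FactRing_def A_RCOSETS_def')
  have carM: "carrier (regular_module (R Quot A)) = carrier (R Quot A)"
    by (simp add: regular_module_def)
  {
    assume L: ?L
    show ?R
    proof (intro allI impI)
      fix C assume C: "compatible_congruences R A C"
      define q where "q = (\<lambda>(x, H). (A +> x, (+>) A ` (H::'a set)))"
      have mem: "x \<in> carrier R" "ideal H R" "A \<subseteq> H" if "(x, H) \<in> C" for x H
        using compatible_congruencesD[OF C that] by auto
      have sol: "solves_congruences (regular_module (R Quot A)) (A +> y) (q ` D) \<longleftrightarrow>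
          (\<forall>(x, H) \<in> D. y \<ominus> x \<in> H)" if y: "y \<in> carrier R" and D: "D \<subseteq> C" for y D
      proof -
        have "A +> (y \<ominus> x) \<in> (+>) A ` H \<longleftrightarrow> y \<ominus> x \<in> H" if "(x, H) \<in> C" for x H
        proof
          assume "A +> (y \<ominus> x) \<in> (+>) A ` H"
          then obtain h where h: "h \<in> H" "A +> (y \<ominus> x) = A +> h" by auto
          interpret H: ideal H R using mem that by auto
          have "(y \<ominus> x) \<ominus> h \<in> H"
            using h mem[OF that] y H.a_Hcarr[OF h(1)] A.rcos_eq_iff[of "y \<ominus> x" h] by auto
          then have "((y \<ominus> x) \<ominus> h) \<oplus> h \<in> H" using h by auto
          moreover have "((y \<ominus> x) \<ominus> h) \<oplus> h = y \<ominus> x"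
            using y mem[OF that] H.a_Hcarr[OF h(1)] by algebra
          ultimately show "y \<ominus> x \<in> H" by simp
        qed auto
        moreover have "(A +> y) \<ominus>\<^bsub>R Quot A\<^esub> (A +> x) = A +> (y \<ominus> x)" if "(x, H) \<in> C" for x H
          using that y mem A.rcos_minus by auto
        ultimately have "(A +> y) \<ominus>\<^bsub>R Quot A\<^esub> (A +> x) \<in> (+>) A ` H \<longleftrightarrow> y \<ominus> x \<in> H"
          if "(x, H) \<in> D" for x H
          using that D by (metis subsetD)
        moreover have "A +> y \<in> carrier (regular_module (R Quot A))"
          using y carM carQ by auto
        ultimately show ?thesis
          by (auto simp: solves_congruences_def q_def regular_module_minus split_def)
      qed
      have "\<forall>(x, H) \<in> q ` C. x \<in> carrier (regular_module (R Quot A))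
              \<and> submodule H (R Quot A) (regular_module (R Quot A))"
        using mem unfolding carM carQ Q.submodule_regular_module_iff_ideal q_def
        by (auto intro!: ring_ideal_imp_quot_ideal[OF A])
      moreover have "\<exists>y. solves_congruences (regular_module (R Quot A)) y F"
        if F: "finite F" "F \<subseteq> q ` C" for F
      proof -
        obtain D where D: "D \<subseteq> C" "finite D" "F = q ` D"
          using finite_subset_image[OF F] by auto
        show ?thesis
        proof (cases "D = {}")
          case True
          then show ?thesis using D carM carQ
            by (auto simp: solves_congruences_def intro!: exI[of _ "A +> \<zero>"])
        next
          case False
          then obtain M where M: "M \<in> snd ` D" "\<And>H. H \<in> snd ` D \<Longrightarrow> H \<subseteq> M \<Longrightarrow> M = H"
            using finite_has_minimal[of "snd ` D"] D(2) by (metis finite_imageI image_is_empty)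
          then obtain x where x: "(x, M) \<in> D" by auto
          have "x \<ominus> x' \<in> H" if "(x', H) \<in> D" for x' H
          proof -
            have "M \<subseteq> H"
              using ideals_total[OF mem(2)[of x M] mem(2)[of x' H]] x that D(1) M(2)[of H]
              by (metis image_eqI snd_conv subsetD)
            then show ?thesis
              using compatible_congruencesD(4)[OF C, of x M x' H] x that D(1) by auto
          qed
          then have "\<forall>(x', H) \<in> D. x \<ominus> x' \<in> H" by auto
          moreover have "x \<in> carrier R" using mem x D(1) by auto
          ultimately show ?thesis using sol[of x D] D(1,3) by metis
        qed
      qed
      ultimately obtain Y where Y: "solves_congruences (regular_module (R Quot A)) Y (q ` C)"
        using L unfolding maximal_ring_def linearly_compact_def by metis
      then obtain y where "y \<in> carrier R" "Y = A +> y"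
        by (auto simp: solves_congruences_def carM carQ)
      then show "\<exists>y \<in> carrier R. \<forall>(x, H) \<in> C. y \<ominus> x \<in> H" using sol[of y C] Y by blast
    qed
  }
  {
    assume R: ?R
    show ?L unfolding maximal_ring_def linearly_compact_def
    proof (intro allI impI)
      fix K assume K: "\<forall>(x, H) \<in> K. x \<in> carrier (regular_module (R Quot A))
              \<and> submodule H (R Quot A) (regular_module (R Quot A))"
        and fin: "\<forall>F. finite F \<and> F \<subseteq> K \<longrightarrow> (\<exists>y. solves_congruences (regular_module (R Quot A)) y F)"
      have memK: "X \<in> carrier (R Quot A)" "ideal H (R Quot A)" if "(X, H) \<in> K" for X H
        using K that carM Q.submodule_regular_module_iff_ideal by auto
      \<comment> \<open>All representatives are taken, so that no choice is needed; those of one coset are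
        congruent modulo every ideal above \<open>A\<close>.\<close>
      define C where "C = {(x, \<Union> H) | x H. x \<in> carrier R \<and> (A +> x, H) \<in> K}"
      have iff: "z \<in> \<Union> H \<longleftrightarrow> A +> z \<in> H" if "ideal H (R Quot A)" "z \<in> carrier R" for z H
        using canonical_proj_vimage_mem_iff[OF A _ that(2), of H]
          additive_subgroup.a_subset[OF ideal.axioms(1)[OF that(1)]] by simp
      have "compatible_congruences R A C"
        unfolding compatible_congruences_def
      proof (clarify, intro conjI, goal_cases)
        case (1 x H) then show ?case by (auto simp: C_def)
      next
        case (2 x H) then show ?case
          using memK quot_ideal_imp_ring_ideal[OF A] by (auto simp: C_def)
      next
        case (3 x H)
        then obtain H' where H': "H = \<Union> H'" "ideal H' (R Quot A)" using memK by (auto simp: C_def)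
        have "A \<in> H'"
          using additive_subgroup.zero_closed[OF ideal.axioms(1)[OF H'(2)]]
          by (simp add: FactRing_def)
        then show ?case using H' by auto
      next
        case (4 x H)
        show ?case
        proof (clarify)
          fix x' G assume G: "(x', G) \<in> C" and sub: "H \<subseteq> G"
          obtain H' where H': "H = \<Union> H'" "(A +> x, H') \<in> K" "x \<in> carrier R"
            using 4 by (auto simp: C_def)
          obtain G' where G': "G = \<Union> G'" "(A +> x', G') \<in> K" "x' \<in> carrier R"
            using G by (auto simp: C_def)
          have "\<exists>y. solves_congruences (regular_module (R Quot A)) y {(A +> x, H'), (A +> x', G')}"
            using H' G' by (intro fin[rule_format]) auto
          then obtain y where y: "y \<in> carrier R" "A +> (y \<ominus> x) \<in> H'" "A +> (y \<ominus> x') \<in> G'"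
            using H' G' A.rcos_minus
            unfolding solves_congruences_def carM carQ regular_module_minus by auto
          have "ideal G R" using quot_ideal_imp_ring_ideal[OF A] G' memK by blast
          moreover have "y \<ominus> x \<in> \<Union> H'"
            using iff[OF memK(2)[OF H'(2)], of "y \<ominus> x"] y H'(3) by simp
          then have "y \<ominus> x \<in> G" using H'(1) sub by blast
          moreover have "y \<ominus> x' \<in> G"
            using iff[OF memK(2)[OF G'(2)], of "y \<ominus> x'"] y G' by simp
          ultimately show "x \<ominus> x' \<in> G"
            using minus_mem_ideal_swap minus_mem_ideal_trans y(1) H'(3) G'(3) by blast
        qed
      qed
      then obtain y where y: "y \<in> carrier R" "\<forall>(x, H) \<in> C. y \<ominus> x \<in> H" using R by blast
      have "(A +> y) \<ominus>\<^bsub>R Quot A\<^esub> X \<in> H" if XH: "(X, H) \<in> K" for X H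
      proof -
        obtain x where x: "x \<in> carrier R" "X = A +> x" using memK(1)[OF XH] carQ by auto
        then have "(x, \<Union> H) \<in> C" using XH by (auto simp: C_def)
        then show ?thesis
          using y x iff[OF memK(2)[OF XH], of "y \<ominus> x"] A.rcos_minus[of y x] by auto
      qed
      then show "\<exists>y. solves_congruences (regular_module (R Quot A)) y K"
        using y(1) unfolding solves_congruences_def carM carQ regular_module_minus by auto
    qed
  }
qed

end

section \<open>Quasi-projective ideals\<close>

text \<open>Such a map picks representatives for the values of a module homomorphism \<open>J \<rightarrow> J/X\<close>; for
  \<open>X = {0}\<close> it is an endomorphism of \<open>J\<close>. Working with representatives avoids computing with cosets.\<close>

definition linear_modulo ::
    "('a, 'm) ring_scheme \<Rightarrow> 'a set \<Rightarrow> 'a set \<Rightarrow> ('a \<Rightarrow> 'a) \<Rightarrow> bool" where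
  "linear_modulo R J X g \<longleftrightarrow> g \<in> J \<rightarrow> J \<and>
     (\<forall>x \<in> J. \<forall>y \<in> J. g (x \<oplus>\<^bsub>R\<^esub> y) \<ominus>\<^bsub>R\<^esub> (g x \<oplus>\<^bsub>R\<^esub> g y) \<in> X) \<and>
     (\<forall>a \<in> carrier R. \<forall>x \<in> J. g (a \<otimes>\<^bsub>R\<^esub> x) \<ominus>\<^bsub>R\<^esub> a \<otimes>\<^bsub>R\<^esub> g x \<in> X)"

lemma (in cring) linear_modulo_zeroD:
  assumes "ideal J R" "linear_modulo R J {\<zero>} f"
  shows "x \<in> J \<Longrightarrow> f x \<in> J"
    and "\<lbrakk>x \<in> J; y \<in> J\<rbrakk> \<Longrightarrow> f (x \<oplus> y) = f x \<oplus> f y"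
    and "\<lbrakk>a \<in> carrier R; x \<in> J\<rbrakk> \<Longrightarrow> f (a \<otimes> x) = a \<otimes> f x"
proof -
  interpret J: ideal J R by (rule assms(1))
  have f: "f x \<in> J" "f x \<in> carrier R" if "x \<in> J" for x
    using assms(2) that J.a_Hcarr by (auto simp: linear_modulo_def Pi_iff)
  show "x \<in> J \<Longrightarrow> f x \<in> J" by (rule f)
  show "\<lbrakk>x \<in> J; y \<in> J\<rbrakk> \<Longrightarrow> f (x \<oplus> y) = f x \<oplus> f y"
    using assms(2) minus_eq_zero_iff[of "f (x \<oplus> y)" "f x \<oplus> f y"] f
    by (simp add: linear_modulo_def)
  show "\<lbrakk>a \<in> carrier R; x \<in> J\<rbrakk> \<Longrightarrow> f (a \<otimes> x) = a \<otimes> f x"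
    using assms(2) minus_eq_zero_iff[of "f (a \<otimes> x)" "a \<otimes> f x"] f
    by (simp add: linear_modulo_def J.I_l_closed)
qed

context chain_ring
begin

lemma submodule_ideal_module_iff:
  assumes J: "ideal J R"
  shows "submodule X R (ideal_module R J) \<longleftrightarrow> ideal X R \<and> X \<subseteq> J"
proof -
  interpret J: ideal J R by (rule J)
  interpret V: module R "ideal_module R J" by (rule module_ideal_module[OF J])
  have neg: "\<ominus>\<^bsub>ideal_module R J\<^esub> x = \<ominus> x" if "x \<in> J" for x
  proof -
    have "\<ominus> x \<oplus>\<^bsub>ideal_module R J\<^esub> x = \<zero>\<^bsub>ideal_module R J\<^esub>"
      using that by (simp add: ideal_module_def regular_module_def l_neg)
    then show ?thesis
      by (rule V.minus_equality) (use that in \<open>auto simp: ideal_module_def\<close>)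
  qed
  show ?thesis
  proof
    assume X: "submodule X R (ideal_module R J)"
    note E = V.submoduleE[OF X]
    have sub: "X \<subseteq> J" using E(1) by (simp add: ideal_module_def)
    have "ideal X R"
    proof (rule idealI)
      show "ring R" by (rule ring_axioms)
      show "subgroup X (add_monoid R)"
        using sub E(2,5) neg E(3)
        by (intro add.subgroupI) (auto simp: ideal_module_def regular_module_def subset_iff)
      show l: "x \<otimes> a \<in> X" if "a \<in> X" "x \<in> carrier R" for a x
        using E(4)[of x a] that by (simp add: ideal_module_def regular_module_def)
      show "a \<otimes> x \<in> X" if "a \<in> X" "x \<in> carrier R" for a x
        using l[OF that] that sub by (metis J.a_Hcarr m_comm subsetD)
    qed
    then show "ideal X R \<and> X \<subseteq> J" using sub by simp
  next
    assume X: "ideal X R \<and> X \<subseteq> J"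
    then interpret X: ideal X R by simp
    show "submodule X R (ideal_module R J)"
    proof (rule V.submoduleI)
      show "\<ominus>\<^bsub>ideal_module R J\<^esub> a \<in> X" if "a \<in> X" for a
        using that X neg by auto
    qed (use X X.I_l_closed in \<open>auto simp: ideal_module_def regular_module_def\<close>)
  qed
qed

text \<open>Every homomorphism into the quotient comes from a map of representatives, and two maps into
  \<open>J\<close> induce the same map into \<open>J/X\<close> if and only if they differ by elements of \<open>X\<close>.\<close>

lemma quasi_projective_ideal_module_iff:
  assumes J: "ideal J R"
  shows "quasi_projective R (ideal_module R J) \<longleftrightarrow>
    (\<forall>X g. ideal X R \<and> X \<subseteq> J \<and> linear_modulo R J X g \<longrightarrow>
       (\<exists>f. linear_modulo R J {\<zero>} f \<and> (\<forall>x \<in> J. f x \<ominus> g x \<in> X)))"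
proof -
  interpret J: ideal J R by (rule J)
  let ?V = "ideal_module R J"
  interpret V: module R ?V by (rule module_ideal_module[OF J])
  have car: "carrier ?V = J" and cosV: "a_r_coset ?V = a_r_coset R"
    and addV: "add ?V = add R" and smV: "smult ?V = monoid.mult R"
    by (auto simp: ideal_module_def regular_module_def fun_eq_iff a_r_coset_def')
  have end_iff: "f \<in> module_hom R ?V ?V \<longleftrightarrow> f \<in> extensional J \<and> linear_modulo R J {\<zero>} f" for f
  proof (cases "f \<in> J \<rightarrow> J")
    case True
    then have fc: "f x \<in> carrier R" if "x \<in> J" for x using that J.a_Hcarr by (metis Pi_mem)
    have "f (x \<oplus> y) \<ominus> (f x \<oplus> f y) = \<zero> \<longleftrightarrow> f (x \<oplus> y) = f x \<oplus> f y" if "x \<in> J" "y \<in> J" for x y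
      using that by (intro minus_eq_zero_iff) (simp_all add: fc)
    moreover have "f (a \<otimes> x) \<ominus> a \<otimes> f x = \<zero> \<longleftrightarrow> f (a \<otimes> x) = a \<otimes> f x"
      if "a \<in> carrier R" "x \<in> J" for a x
      using that by (intro minus_eq_zero_iff) (simp_all add: fc J.I_l_closed)
    ultimately show ?thesis
      using True by (simp add: module_hom_def linear_modulo_def car addV smV PiE_def)
  next
    case False
    then show ?thesis by (auto simp: module_hom_def linear_modulo_def car PiE_def)
  qed
  have hom_iff: "restrict (\<lambda>x. X +> g x) J \<in> module_hom R ?V (quotient_module ?V X)
      \<longleftrightarrow> linear_modulo R J X g"
    if X: "ideal X R" "X \<subseteq> J" and g: "g \<in> J \<rightarrow> J" for X g
  proof -
    interpret X: ideal X R by (rule X)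
    have sub: "submodule X R ?V" using X submodule_ideal_module_iff[OF J] by simp
    have gc: "g x \<in> J" "g x \<in> carrier R" if "x \<in> J" for x using g that J.a_Hcarr by (metis Pi_mem)+
    have add: "(X +> g x) \<oplus>\<^bsub>quotient_module ?V X\<^esub> (X +> g y) = X +> (g x \<oplus> g y)"
      if "x \<in> J" "y \<in> J" for x y
      using X.a_rcos_sum[OF gc(2)[OF that(1)] gc(2)[OF that(2)]]
      by (simp add: quotient_module_def set_add_def set_mult_def addV)
    have sm: "a \<odot>\<^bsub>quotient_module ?V X\<^esub> (X +> g x) = X +> (a \<otimes> g x)"
      if "a \<in> carrier R" "x \<in> J" for a x
      using V.quotient_smult[OF sub that(1), of "g x"] gc that by (simp add: car cosV smV)
    have cl: "X +> g x \<in> carrier (quotient_module ?V X)" if "x \<in> J" for x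
      using gc[OF that]
      by (auto simp: quotient_module_def A_RCOSETS_def' car cosV)
    show ?thesis
      unfolding module_hom_def linear_modulo_def car addV smV
      using cl g
      by (auto simp: add sm J.I_l_closed gc X.rcos_eq_iff)
  qed
  have hom_rep: "\<exists>g \<in> J \<rightarrow> J. h = restrict (\<lambda>x. X +> g x) J"
    if X: "ideal X R" "X \<subseteq> J" and h: "h \<in> module_hom R ?V (quotient_module ?V X)" for X h
  proof -
    have he: "h \<in> J \<rightarrow>\<^sub>E (a_rcosets\<^bsub>?V\<^esub> X)"
      using h by (simp add: module_hom_def car quotient_module_def)
    then have "\<forall>x \<in> J. \<exists>v \<in> J. h x = X +> v"
      by (auto simp: A_RCOSETS_def' car cosV dest!: PiE_mem)
    then obtain g where "\<forall>x \<in> J. g x \<in> J \<and> h x = X +> g x" by metis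
    then show ?thesis using he
      by (intro bexI[of _ g] extensionalityI[of h J]) (auto simp: PiE_def)
  qed
  have comp: "compose (carrier ?V) (\<lambda>v. X +>\<^bsub>?V\<^esub> v) f = restrict (\<lambda>x. X +> f x) J" for X f
    by (simp add: compose_def car cosV)
  have weaken: "linear_modulo R J X f" if "ideal X R" "linear_modulo R J {\<zero>} f" for X f
    using that additive_subgroup.zero_closed[OF ideal.axioms(1)]
    by (auto simp: linear_modulo_def)
  have eq_iff: "restrict (\<lambda>x. X +> f x) J = restrict (\<lambda>x. X +> g x) J \<longleftrightarrow> (\<forall>x \<in> J. f x \<ominus> g x \<in> X)"
    if X: "ideal X R" and "f \<in> J \<rightarrow> J" "g \<in> J \<rightarrow> J" for X f g
  proof -
    have "X +> f x = X +> g x \<longleftrightarrow> f x \<ominus> g x \<in> X" if "x \<in> J" for x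
      using ideal.rcos_eq_iff[OF X] that \<open>f \<in> J \<rightarrow> J\<close> \<open>g \<in> J \<rightarrow> J\<close> J.a_Hcarr
      by (metis Pi_mem)
    then show ?thesis by (auto simp: fun_eq_iff restrict_def)
  qed
  have incl: "(\<lambda>f. compose (carrier ?V) (\<lambda>v. X +>\<^bsub>?V\<^esub> v) f) ` module_hom R ?V ?V
      \<subseteq> module_hom R ?V (quotient_module ?V X)" if X: "ideal X R" "X \<subseteq> J" for X
  proof (rule image_subsetI)
    fix f assume "f \<in> module_hom R ?V ?V"
    then have f: "linear_modulo R J {\<zero>} f" by (simp add: end_iff)
    then have "f \<in> J \<rightarrow> J" by (simp add: linear_modulo_def)
    then show "compose (carrier ?V) (\<lambda>v. X +>\<^bsub>?V\<^esub> v) f \<in> module_hom R ?V (quotient_module ?V X)"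
      unfolding comp using hom_iff[OF X] weaken[OF X(1) f] by blast
  qed
  show ?thesis
  proof
    assume q: "quasi_projective R ?V"
    show "\<forall>X g. ideal X R \<and> X \<subseteq> J \<and> linear_modulo R J X g \<longrightarrow>
       (\<exists>f. linear_modulo R J {\<zero>} f \<and> (\<forall>x \<in> J. f x \<ominus> g x \<in> X))"
    proof (intro allI impI, elim conjE)
      fix X g assume X: "ideal X R" "X \<subseteq> J" and g: "linear_modulo R J X g"
      then have gJ: "g \<in> J \<rightarrow> J" by (simp add: linear_modulo_def)
      have "restrict (\<lambda>x. X +> g x) J \<in>
          (\<lambda>f. compose (carrier ?V) (\<lambda>v. X +>\<^bsub>?V\<^esub> v) f) ` module_hom R ?V ?V"
        using hom_iff[OF X gJ] g q X submodule_ideal_module_iff[OF J]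
        unfolding quasi_projective_def by metis
      then obtain f where f: "linear_modulo R J {\<zero>} f"
          "restrict (\<lambda>x. X +> f x) J = restrict (\<lambda>x. X +> g x) J"
        unfolding comp using end_iff by auto
      then have "f \<in> J \<rightarrow> J" by (simp add: linear_modulo_def)
      then show "\<exists>f. linear_modulo R J {\<zero>} f \<and> (\<forall>x \<in> J. f x \<ominus> g x \<in> X)"
        using f eq_iff[OF X(1) _ gJ] by blast
    qed
  next
    assume lift: "\<forall>X g. ideal X R \<and> X \<subseteq> J \<and> linear_modulo R J X g \<longrightarrow>
       (\<exists>f. linear_modulo R J {\<zero>} f \<and> (\<forall>x \<in> J. f x \<ominus> g x \<in> X))"
    show "quasi_projective R ?V"
      unfolding quasi_projective_def
    proof (intro allI impI)
      fix X assume "submodule X R ?V"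
      then have X: "ideal X R" "X \<subseteq> J" using submodule_ideal_module_iff[OF J] by auto
      have "h \<in> (\<lambda>f. compose (carrier ?V) (\<lambda>v. X +>\<^bsub>?V\<^esub> v) f) ` module_hom R ?V ?V"
        if h: "h \<in> module_hom R ?V (quotient_module ?V X)" for h
      proof -
        obtain g where g: "g \<in> J \<rightarrow> J" "h = restrict (\<lambda>x. X +> g x) J"
          using hom_rep[OF X h] by blast
        then obtain f where f: "linear_modulo R J {\<zero>} f" "\<forall>x \<in> J. f x \<ominus> g x \<in> X"
          using lift X h hom_iff[OF X g(1)] by blast
        then have fJ: "f \<in> J \<rightarrow> J" by (simp add: linear_modulo_def)
        have "restrict f J \<in> module_hom R ?V ?V"
          using f(1) unfolding end_iff linear_modulo_def by (auto simp: J.I_l_closed)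
        moreover have "h = restrict (\<lambda>x. X +> restrict f J x) J"
          using eq_iff[OF X(1) fJ g(1)] f(2) g(2) by (auto cong: restrict_cong)
        ultimately show ?thesis unfolding comp by blast
      qed
      then show "(\<lambda>f. compose (carrier ?V) (\<lambda>v. X +>\<^bsub>?V\<^esub> v) f) ` module_hom R ?V ?V
          = module_hom R ?V (quotient_module ?V X)" using incl[OF X] by blast
    qed
  qed
qed

end

section \<open>Ideals and divisibility\<close>

lemma (in cring) ideal_of_closed:
  assumes "H \<subseteq> carrier R" "\<zero> \<in> H"
    and add: "\<And>x y. \<lbrakk>x \<in> H; y \<in> H\<rbrakk> \<Longrightarrow> x \<oplus> y \<in> H"
    and mult: "\<And>a x. \<lbrakk>a \<in> carrier R; x \<in> H\<rbrakk> \<Longrightarrow> a \<otimes> x \<in> H"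
  shows "ideal H R"
proof (rule idealI)
  show "ring R" by (rule ring_axioms)
  show "subgroup H (add_monoid R)"
  proof (rule add.subgroupI)
    fix x assume x: "x \<in> H"
    then have "\<ominus> x = (\<ominus> \<one>) \<otimes> x" using assms(1) l_minus by auto
    then show "\<ominus> x \<in> H" using mult[OF _ x, of "\<ominus> \<one>"] by simp
  qed (use assms in auto)
  show "a \<otimes> x \<in> H" if "x \<in> H" "a \<in> carrier R" for a x using mult that by simp
  then show "x \<otimes> a \<in> H" if "x \<in> H" "a \<in> carrier R" for a x
    using that assms(1) by (metis m_comm subsetD)
qed

lemma (in cring) annihilator_ideal:
  assumes "y \<in> carrier R"
  shows "ideal {x \<in> carrier R. y \<otimes> x = \<zero>} R"
proof (rule ideal_of_closed)
  show "a \<otimes> x \<in> {x \<in> carrier R. y \<otimes> x = \<zero>}"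
    if "a \<in> carrier R" "x \<in> {x \<in> carrier R. y \<otimes> x = \<zero>}" for a x
    using that assms m_lcomm[of y a x] by simp
qed (use assms in \<open>auto simp: r_distr\<close>)

lemma (in cring) colon_ideal:
  assumes H: "ideal H R" and y: "y \<in> carrier R"
  shows "ideal {x \<in> carrier R. y \<otimes> x \<in> H} R"
proof -
  interpret H: ideal H R by (rule H)
  show ?thesis
  proof (rule ideal_of_closed)
    show "a \<otimes> x \<in> {x \<in> carrier R. y \<otimes> x \<in> H}"
      if "a \<in> carrier R" "x \<in> {x \<in> carrier R. y \<otimes> x \<in> H}" for a x
      using that y m_lcomm[of y a x] H.I_l_closed by simp
  qed (use y in \<open>auto simp: r_distr\<close>)
qed

context chain_ring
begin

lemma dvd_total:
  assumes "a \<in> carrier R" "b \<in> carrier R"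
  shows "(\<exists>c \<in> carrier R. a = c \<otimes> b) \<or> (\<exists>c \<in> carrier R. b = c \<otimes> a)"
  using ideals_total[OF cgenideal_ideal[OF assms(1)] cgenideal_ideal[OF assms(2)]]
    cgenideal_self[OF assms(1)] cgenideal_self[OF assms(2)]
  by (auto simp: cgenideal_def)

lemma dvd_of_mem_of_notin:
  assumes I: "ideal I R" and x: "x \<in> carrier R" "x \<notin> I" and y: "y \<in> I"
  obtains c where "c \<in> carrier R" "y = c \<otimes> x"
  using dvd_total[OF ideal.Icarr[OF I y] x(1)] ideal.I_l_closed[OF I y] x(2) by auto

text \<open>A chain ring is local: whichever of \<open>m\<close> and \<open>1 - m\<close> divides the other also divides their
  sum \<open>1\<close>.\<close>

lemma unit_or_one_minus_unit:
  assumes m: "m \<in> carrier R"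
  obtains u where "u \<in> carrier R" "u \<otimes> m = \<one> \<or> u \<otimes> (\<one> \<ominus> m) = \<one>"
proof -
  have "\<one> \<ominus> m \<in> carrier R" using m by simp
  from dvd_total[OF m this] show thesis
  proof (elim disjE bexE)
    fix c assume c: "c \<in> carrier R" "m = c \<otimes> (\<one> \<ominus> m)"
    have "(c \<oplus> \<one>) \<otimes> (\<one> \<ominus> m) = c \<otimes> (\<one> \<ominus> m) \<oplus> (\<one> \<ominus> m)"
      using c(1) m by algebra
    also have "\<dots> = m \<oplus> (\<one> \<ominus> m)" using c(2) by simp
    also have "\<dots> = \<one>" using m by algebra
    finally show thesis using that[of "c \<oplus> \<one>"] c(1) by simp
  next
    fix c assume c: "c \<in> carrier R" "\<one> \<ominus> m = c \<otimes> m"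
    have "(c \<oplus> \<one>) \<otimes> m = c \<otimes> m \<oplus> m" using c(1) m by algebra
    also have "\<dots> = (\<one> \<ominus> m) \<oplus> m" using c(2) by simp
    also have "\<dots> = \<one>" using m by algebra
    finally show thesis using that[of "c \<oplus> \<one>"] c(1) by simp
  qed
qed

text \<open>As \<open>y \<notin> X\<close>, it divides every element of \<open>X\<close>, and \<open>z = (1 + m) y\<close> with \<open>m y \<in> X\<close>. The factor \<open>m\<close>
  is not a unit, again because \<open>y \<notin> X\<close>, so \<open>1 + m\<close> is one.\<close>

lemma associate_of_congruent:
  assumes X: "ideal X R" and y: "y \<in> carrier R" "y \<notin> X"
    and z: "z \<in> carrier R" "z \<ominus> y \<in> X"
  obtains e e' where "e \<in> carrier R" "e' \<in> carrier R" "e \<otimes> e' = \<one>" "z = e \<otimes> y"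
proof -
  obtain m where m: "m \<in> carrier R" "z \<ominus> y = m \<otimes> y"
    using dvd_of_mem_of_notin[OF X y z(2)] .
  have "z = (z \<ominus> y) \<oplus> y" using y z by algebra
  then have zm: "z = (\<one> \<oplus> m) \<otimes> y"
    using m y by (simp add: l_distr a_comm)
  obtain u where u: "u \<in> carrier R" "u \<otimes> (\<ominus> m) = \<one> \<or> u \<otimes> (\<one> \<ominus> (\<ominus> m)) = \<one>"
    using unit_or_one_minus_unit[of "\<ominus> m"] m by auto
  have "u \<otimes> (\<ominus> m) \<noteq> \<one>"
  proof
    assume "u \<otimes> (\<ominus> m) = \<one>"
    then have "y = (u \<otimes> (\<ominus> m)) \<otimes> y" using y by simp
    also have "\<dots> = (\<ominus> u) \<otimes> (m \<otimes> y)" using u m y by algebra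
    finally show False
      using ideal.I_l_closed[OF X z(2), of "\<ominus> u"] u y(2) m(2) by simp
  qed
  then have "u \<otimes> (\<one> \<oplus> m) = \<one>" using u m by (simp add: minus_eq)
  then show thesis
    using that[of "\<one> \<oplus> m" u] zm u m by (simp add: m_comm)
qed

end

section \<open>Zerodivisors and nilpotent elements\<close>

lemma (in cring) nilradical_subset_zerodivisors: "nilradical R \<subseteq> zerodivisors R"
proof
  fix a assume "a \<in> nilradical R"
  then have a: "a \<in> carrier R" and ex: "\<exists>n::nat. a [^] n = \<zero>" by (auto simp: nilradical_def)
  define n where "n = (LEAST n::nat. a [^] n = \<zero>)"
  have n: "a [^] n = \<zero>" unfolding n_def using ex by (rule LeastI_ex)
  show "a \<in> zerodivisors R"
  proof (cases n)
    case 0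
    then have "\<one> = \<zero>" using n by simp
    then have "a = \<zero>" using a by (metis l_null l_one)
    then show ?thesis using a by (simp add: zerodivisors_def)
  next
    case (Suc m)
    then have "a [^] m \<noteq> \<zero>" using not_less_Least[of m "\<lambda>n. a [^] n = \<zero>"] n_def by simp
    moreover have "a \<otimes> a [^] m = \<zero>" using n Suc a by (simp add: m_comm)
    ultimately show ?thesis using a by (auto simp: zerodivisors_def)
  qed
qed

context chain_ring
begin

text \<open>For a zerodivisor \<open>z\<close> that is not nilpotent, multiplication by \<open>z\<close> maps \<open>J = \<Inter>\<^sub>n R z\<^sup>n\<close> onto
  itself, and \<open>J\<close> contains the annihilator of \<open>z\<close>. Quasi-projectivity of \<open>J\<close> provides a linear
  section \<open>f\<close> of this surjection, and \<open>f (z x) = z f(x) = x\<close> shows that it would be injective.\<close>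

lemma zerodivisors_subset_nilradical:
  assumes qp: "\<And>J. ideal J R \<Longrightarrow> quasi_projective R (ideal_module R J)"
  shows "zerodivisors R \<subseteq> nilradical R"
proof
  fix z assume zZ: "z \<in> zerodivisors R"
  then have z: "z \<in> carrier R" by (simp add: zerodivisors_def)
  show "z \<in> nilradical R"
  proof (rule ccontr)
    assume "z \<notin> nilradical R"
    then have pow: "z [^] (n::nat) \<noteq> \<zero>" for n using z by (auto simp: nilradical_def)
    then have "z \<noteq> \<zero>" using pow[of 1] z by auto
    then obtain b where b: "b \<in> carrier R" "b \<noteq> \<zero>" "z \<otimes> b = \<zero>"
      using zZ by (auto simp: zerodivisors_def)
    define J where "J = {x \<in> carrier R. \<forall>n::nat. \<exists>c \<in> carrier R. x = c \<otimes> z [^] n}"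
    define K where "K = {y \<in> carrier R. z \<otimes> y = \<zero>}"
    have J: "ideal J R"
    proof (rule ideal_of_closed)
      show "\<zero> \<in> J" using z by (auto simp: J_def intro!: bexI[of _ \<zero>])
      show "x \<oplus> y \<in> J" if xy: "x \<in> J" "y \<in> J" for x y
      proof -
        have "\<exists>c \<in> carrier R. x \<oplus> y = c \<otimes> z [^] n" for n :: nat
        proof -
          obtain c d where "c \<in> carrier R" "x = c \<otimes> z [^] n" "d \<in> carrier R" "y = d \<otimes> z [^] n"
            using xy unfolding J_def by blast
          then show ?thesis using z by (intro bexI[of _ "c \<oplus> d"]) (simp_all add: l_distr)
        qed
        then show ?thesis using xy by (simp add: J_def)
      qed
      show "a \<otimes> x \<in> J" if a: "a \<in> carrier R" and x: "x \<in> J" for a x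
      proof -
        have "\<exists>c \<in> carrier R. a \<otimes> x = c \<otimes> z [^] n" for n :: nat
        proof -
          obtain c where "c \<in> carrier R" "x = c \<otimes> z [^] n"
            using x unfolding J_def by blast
          then show ?thesis using z a by (intro bexI[of _ "a \<otimes> c"]) (simp_all add: m_assoc)
        qed
        then show ?thesis using x a by (simp add: J_def)
      qed
    qed (auto simp: J_def)
    have K: "ideal K R" unfolding K_def by (rule annihilator_ideal[OF z])
    have KJ: "K \<subseteq> J"
    proof
      fix y assume "y \<in> K"
      then have y: "y \<in> carrier R" "z \<otimes> y = \<zero>" by (auto simp: K_def)
      have "\<exists>c \<in> carrier R. y = c \<otimes> z [^] n" for n :: nat
      proof (rule ccontr)
        assume "\<not> ?thesis"
        then obtain c where c: "c \<in> carrier R" "z [^] n = c \<otimes> y"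
          using dvd_total[OF y(1) nat_pow_closed[OF z]] by blast
        have "z [^] Suc n = c \<otimes> y \<otimes> z" using c by simp
        also have "\<dots> = c \<otimes> (z \<otimes> y)" using c y z by algebra
        also have "\<dots> = \<zero>" using c y by simp
        finally show False using pow by blast
      qed
      then show "y \<in> J" using y by (simp add: J_def)
    qed
    interpret J: ideal J R by (rule J)
    \<comment> \<open>Writing \<open>x\<close> as a multiple of \<open>z\<^sup>n\<^sup>+\<^sup>1\<close> determines a preimage up to the annihilator of \<open>z\<close>,
      which lies in \<open>J\<close>; so every preimage is a multiple of each \<open>z\<^sup>n\<close>.\<close>
    have "\<exists>y \<in> J. z \<otimes> y = x" if x: "x \<in> J" for x
    proof -
      obtain y where y: "y \<in> carrier R" "x = y \<otimes> z"
        using x z unfolding J_def by (auto dest!: spec[of _ 1])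
      have "\<exists>c \<in> carrier R. y = c \<otimes> z [^] n" for n :: nat
      proof -
        obtain c where c: "c \<in> carrier R" "x = c \<otimes> z [^] Suc n"
          using x unfolding J_def by blast
        have zn: "z [^] n \<in> carrier R" using z by simp
        have "z \<otimes> (y \<ominus> c \<otimes> z [^] n) = y \<otimes> z \<ominus> c \<otimes> (z [^] n \<otimes> z)"
          using y c z zn by algebra
        also have "\<dots> = \<zero>" using y c z by (simp add: minus_eq r_neg)
        finally have "y \<ominus> c \<otimes> z [^] n \<in> J" using KJ y c z by (auto simp: K_def)
        then obtain d where d: "d \<in> carrier R" "y \<ominus> c \<otimes> z [^] n = d \<otimes> z [^] n"
          unfolding J_def by blast
        have "y = (y \<ominus> c \<otimes> z [^] n) \<oplus> c \<otimes> z [^] n" using y c zn by algebra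
        also have "\<dots> = (d \<oplus> c) \<otimes> z [^] n" using d c zn by (simp add: l_distr)
        finally show ?thesis using d(1) c(1) by (intro bexI[of _ "d \<oplus> c"]) simp_all
      qed
      then have "y \<in> J" using y(1) unfolding J_def by blast
      moreover have "z \<otimes> y = x" using y z m_comm by simp
      ultimately show ?thesis by blast
    qed
    then have "\<forall>x \<in> J. \<exists>y. y \<in> J \<and> z \<otimes> y = x" by blast
    from bchoice[OF this] obtain g
      where g: "\<And>x. x \<in> J \<Longrightarrow> g x \<in> J" "\<And>x. x \<in> J \<Longrightarrow> z \<otimes> g x = x" by blast
    have gc: "g x \<in> carrier R" if "x \<in> J" for x using g(1)[OF that] J.a_Hcarr by blast
    have "linear_modulo R J K g"
      unfolding linear_modulo_def
    proof (intro conjI ballI)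
      show "g \<in> J \<rightarrow> J" using g by blast
      fix x y assume xy: "x \<in> J" "y \<in> J"
      have "z \<otimes> (g (x \<oplus> y) \<ominus> (g x \<oplus> g y)) = z \<otimes> g (x \<oplus> y) \<ominus> (z \<otimes> g x \<oplus> z \<otimes> g y)"
        using xy gc z J.a_closed[OF xy] by (simp add: minus_eq r_distr minus_add r_minus)
      also have "\<dots> = \<zero>" using xy g(2) by (simp add: minus_eq r_neg)
      finally show "g (x \<oplus> y) \<ominus> (g x \<oplus> g y) \<in> K" using xy gc by (simp add: K_def)
    next
      fix a x assume a: "a \<in> carrier R" and x: "x \<in> J"
      have ax: "a \<otimes> x \<in> J" using J.I_l_closed a x by simp
      have "z \<otimes> (g (a \<otimes> x) \<ominus> a \<otimes> g x) = z \<otimes> g (a \<otimes> x) \<ominus> a \<otimes> (z \<otimes> g x)"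
        using gc[OF ax] gc[OF x] a z by algebra
      also have "\<dots> = \<zero>" using x a ax g(2) by (simp add: minus_eq r_neg)
      finally show "g (a \<otimes> x) \<ominus> a \<otimes> g x \<in> K" using x a ax gc by (simp add: K_def)
    qed
    then obtain f where f: "linear_modulo R J {\<zero>} f" "\<And>x. x \<in> J \<Longrightarrow> f x \<ominus> g x \<in> K"
      using quasi_projective_ideal_module_iff[OF J] qp[OF J] K KJ by blast
    note lin = linear_modulo_zeroD[OF J f(1)]
    have bJ: "b \<in> J" using b KJ by (auto simp: K_def)
    have fc: "f b \<in> carrier R" using lin(1)[OF bJ] J.a_Hcarr by blast
    have "z \<otimes> f b = z \<otimes> (f b \<ominus> g b) \<oplus> z \<otimes> g b" using fc gc[OF bJ] z by algebra
    also have "\<dots> = b" using f(2)[OF bJ] g(2)[OF bJ] b by (simp add: K_def)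
    finally have "f (z \<otimes> b) = b" using lin(3)[OF z bJ] by simp
    moreover have "f (\<zero> \<otimes> b) = \<zero>" using lin(3)[OF zero_closed bJ] fc by simp
    ultimately show False using b by simp
  qed
qed

end

section \<open>Almost maximality from quasi-projective ideals\<close>

context chain_ring
begin

text \<open>In terms of colon ideals: \<open>(I : t)\<close> contains \<open>s\<close> and the annihilator of \<open>s\<close>. Without the freedom
  to choose \<open>t\<close> this fails: for \<open>t = 1\<close> and \<open>I\<close> the smallest nonzero ideal of the ring of integers
  modulo 8, the annihilator of the only nonzero \<open>s \<in> I\<close> is the maximal ideal.\<close>

lemma exists_element_with_small_annihilator:
  assumes Z: "zerodivisors R \<subseteq> nilradical R"
    and I: "ideal I R" "I \<noteq> {\<zero>}" "I \<noteq> carrier R"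
  obtains t s where "t \<in> carrier R" "t \<notin> I" "s \<in> carrier R" "t \<otimes> s \<in> I"
    "\<And>x. \<lbrakk>x \<in> carrier R; s \<otimes> x = \<zero>\<rbrakk> \<Longrightarrow> t \<otimes> x \<in> I"
proof -
  interpret I: ideal I R by (rule I)
  show thesis
  proof (cases "\<exists>t \<in> carrier R - I. t \<otimes> t \<in> I")
    case True
    then obtain t where "t \<in> carrier R" "t \<notin> I" "t \<otimes> t \<in> I" by auto
    then show thesis using that[of t t] I.zero_closed by simp
  next
    case False
    have one: "\<one> \<notin> I" using I.one_imp_carrier I(3) by blast
    \<comment> \<open>If \<open>n\<close> is the least exponent with \<open>a\<^sup>n \<in> I\<close> and \<open>n \<ge> 2\<close>, then \<open>a\<close> to the power \<open>n - 1\<close> is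
      outside \<open>I\<close> and has its square in \<open>I\<close>.\<close>
    have nil: "a \<in> I" if aN: "a \<in> nilradical R" for a
    proof -
      obtain k :: nat where a: "a \<in> carrier R" and "a [^] k = \<zero>"
        using aN by (auto simp: nilradical_def)
      then have "\<exists>n::nat. a [^] n \<in> I" using I.zero_closed by (intro exI[of _ k]) simp
      then have n: "a [^] (LEAST n::nat. a [^] n \<in> I) \<in> I" (is "a [^] ?n \<in> I")
        by (rule LeastI_ex)
      show "a \<in> I"
      proof (rule ccontr)
        assume "a \<notin> I"
        have "a [^] (0::nat) = \<one>" "a [^] (1::nat) = a" using a by simp_all
        then have "?n \<noteq> 0" "?n \<noteq> 1" using n one \<open>a \<notin> I\<close> by metis+
        then obtain m where m: "?n = Suc (Suc m)" by (metis One_nat_def not0_implies_Suc)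
        have "a [^] Suc m \<notin> I" using not_less_Least[of "Suc m" "\<lambda>n. a [^] n \<in> I"] m by simp
        moreover have "a [^] Suc m \<otimes> a [^] Suc m = a [^] m \<otimes> a [^] ?n"
          using a unfolding m by (simp only: nat_pow_mult) simp
        then have "a [^] Suc m \<otimes> a [^] Suc m \<in> I"
          using I.I_l_closed[OF n, of "a [^] m"] a by simp
        ultimately show False using False a by (metis DiffI nat_pow_closed)
      qed
    qed
    obtain s where s: "s \<in> I" "s \<noteq> \<zero>" using I(2) I.zero_closed by blast
    have sc: "s \<in> carrier R" using s(1) by (rule I.a_Hcarr)
    have "x \<in> I" if x: "x \<in> carrier R" "s \<otimes> x = \<zero>" for x
    proof -
      have "x \<otimes> s = \<zero>" using m_comm[OF x(1) sc] x(2) by simp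
      then have "x \<in> zerodivisors R" using x(1) s(2) sc unfolding zerodivisors_def by blast
      then show ?thesis using nil Z by blast
    qed
    then show thesis using that[of \<one> s] one s sc by simp
  qed
qed

text \<open>The homomorphism to be lifted multiplies by the values of the system: if \<open>x G \<subseteq> R s\<close> for a
  congruence \<open>(b, G)\<close>, then the class of \<open>b x\<close> modulo \<open>R s\<close> depends only on \<open>x\<close>. A lift \<open>f\<close> remembers
  the whole system in its single value \<open>f s = c s\<close>, since \<open>s\<close> is a multiple \<open>u v\<close> of elements \<open>v\<close>
  on which \<open>f\<close> is controlled by a congruence of the system. Cancelling \<open>s\<close> introduces an error in
  the annihilator of \<open>s\<close>, which all moduli contain. The absence of a smallest modulus supplies the
  elements \<open>u\<close>.\<close>

lemma solvable_of_quasi_projective: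
  assumes qp: "\<And>J. ideal J R \<Longrightarrow> quasi_projective R (ideal_module R J)"
    and s: "s \<in> carrier R"
    and B: "compatible_congruences R (insert s {x \<in> carrier R. s \<otimes> x = \<zero>}) B"
    and strict: "\<And>b G. (b, G) \<in> B \<Longrightarrow> \<exists>(b', G') \<in> B. G' \<subset> G"
  obtains c where "c \<in> carrier R" "\<And>b G. (b, G) \<in> B \<Longrightarrow> c \<ominus> b \<in> G"
proof (cases "B = {}")
  case True
  then show thesis using that[of \<zero>] by simp
next
  case False
  define X where "X = PIdl s"
  have X: "ideal X R" unfolding X_def by (rule cgenideal_ideal[OF s])
  have sX: "s \<in> X" unfolding X_def by (rule cgenideal_self[OF s])
  interpret X: ideal X R by (rule X)
  have bc: "b \<in> carrier R" and G: "ideal G R" and sG: "s \<in> G"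
    and annG: "\<And>x. \<lbrakk>x \<in> carrier R; s \<otimes> x = \<zero>\<rbrakk> \<Longrightarrow> x \<in> G" if "(b, G) \<in> B" for b G
    using compatible_congruencesD(1-3)[OF B that] by auto
  have comp: "b \<ominus> b' \<in> G'" if "(b, G) \<in> B" "(b', G') \<in> B" "G \<subseteq> G'" for b G b' G'
    using compatible_congruencesD(4)[OF B that] .
  define W where "W = (\<lambda>x p. p \<in> B \<and> (\<forall>g \<in> snd p. x \<otimes> g \<in> X))"
  \<comment> \<open>\<open>J\<close> is the union of the ideals \<open>(X : G)\<close> over all moduli \<open>G\<close>, which form a chain.\<close>
  define J where "J = {x \<in> carrier R. \<exists>p. W x p}"
  have JW: "\<exists>b G. W x (b, G)" if "x \<in> J" for x
    using that by (auto simp: J_def)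
  have common: "\<exists>b G. W x (b, G) \<and> W y (b, G)" if "W x p" "W y q" for x y p q
  proof -
    obtain b G b' G' where pq: "p = (b, G)" "q = (b', G')" by (cases p, cases q)
    then have "G \<subseteq> G' \<or> G' \<subseteq> G" using that G ideals_total unfolding W_def by blast
    then have "W y p \<or> W x q" using that pq unfolding W_def by auto
    then show ?thesis using that pq by blast
  qed
  have W_add: "W (x \<oplus> y) (b, G)"
    if "W x (b, G)" "W y (b, G)" "x \<in> carrier R" "y \<in> carrier R" for x y b G
  proof -
    have bG: "(b, G) \<in> B" using that(1) by (simp add: W_def)
    have "(x \<oplus> y) \<otimes> g \<in> X" if g: "g \<in> G" for g
    proof -
      have "g \<in> carrier R" using ideal.Icarr[OF G[OF bG] g] .
      moreover have "x \<otimes> g \<in> X" "y \<otimes> g \<in> X" using that \<open>W x (b, G)\<close> \<open>W y (b, G)\<close> by (auto simp: W_def)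
      ultimately show ?thesis
        using \<open>x \<in> carrier R\<close> \<open>y \<in> carrier R\<close> by (simp add: l_distr)
    qed
    then show ?thesis using bG by (simp add: W_def)
  qed
  have W_mult: "W (a \<otimes> x) (b, G)"
    if "W x (b, G)" "x \<in> carrier R" "a \<in> carrier R" for x a b G
  proof -
    have bG: "(b, G) \<in> B" using that(1) by (simp add: W_def)
    have "(a \<otimes> x) \<otimes> g \<in> X" if g: "g \<in> G" for g
    proof -
      have "g \<in> carrier R" using ideal.Icarr[OF G[OF bG] g] .
      moreover have "x \<otimes> g \<in> X" using g \<open>W x (b, G)\<close> by (auto simp: W_def)
      ultimately show ?thesis
        using \<open>x \<in> carrier R\<close> \<open>a \<in> carrier R\<close> X.I_l_closed by (simp add: m_assoc)
    qed
    then show ?thesis using bG by (simp add: W_def)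
  qed
  have XJ: "X \<subseteq> J"
  proof
    fix x assume x: "x \<in> X"
    obtain b G where bG: "(b, G) \<in> B" using False by auto
    have "x \<otimes> g \<in> X" if "g \<in> G" for g
      using X.I_r_closed[OF x] ideal.Icarr[OF G[OF bG] that] by blast
    then have "W x (b, G)" using bG by (simp add: W_def)
    then show "x \<in> J" using X.a_Hcarr[OF x] unfolding J_def by blast
  qed
  have J: "ideal J R"
  proof (rule ideal_of_closed)
    show "J \<subseteq> carrier R" by (auto simp: J_def)
    show "\<zero> \<in> J" using XJ X.zero_closed by blast
    show "x \<oplus> y \<in> J" if x: "x \<in> J" and y: "y \<in> J" for x y
    proof -
      obtain b G where "W x (b, G)" "W y (b, G)" using x y common unfolding J_def by blast
      then have "W (x \<oplus> y) (b, G)" using W_add x y by (simp add: J_def)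
      then show ?thesis using x y unfolding J_def by blast
    qed
    show "a \<otimes> x \<in> J" if a: "a \<in> carrier R" and x: "x \<in> J" for a x
    proof -
      obtain b G where "W x (b, G)" using x unfolding J_def by auto
      then have "W (a \<otimes> x) (b, G)" using W_mult a x by (simp add: J_def)
      then show ?thesis using a x unfolding J_def by blast
    qed
  qed
  interpret J: ideal J R by (rule J)
  define \<phi> where "\<phi> = (\<lambda>x. fst (SOME p. W x p) \<otimes> x)"
  have wd: "\<phi> x \<ominus> b \<otimes> x \<in> X" if x: "x \<in> J" and W: "W x (b, G)" for x b G
  proof -
    have xc: "x \<in> carrier R" using x by (rule J.a_Hcarr)
    obtain b' G' where eq: "(SOME p. W x p) = (b', G')" by (meson surj_pair)
    have W': "W x (b', G')" unfolding eq[symmetric] by (rule someI) (rule W)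
    have mem: "(b, G) \<in> B" "(b', G') \<in> B" using W W' by (auto simp: W_def)
    have "b' \<ominus> b \<in> G \<or> b' \<ominus> b \<in> G'"
      using ideals_total[OF G[OF mem(1)] G[OF mem(2)]] comp[OF mem(2) mem(1)]
        comp[OF mem] minus_mem_ideal_swap[OF G[OF mem(2)] bc[OF mem(1)] bc[OF mem(2)]] by blast
    then have "x \<otimes> (b' \<ominus> b) \<in> X" using W W' by (auto simp: W_def)
    moreover have "\<phi> x \<ominus> b \<otimes> x = x \<otimes> (b' \<ominus> b)"
      unfolding \<phi>_def eq fst_conv using xc bc[OF mem(1)] bc[OF mem(2)] by algebra
    ultimately show ?thesis by simp
  qed
  have \<phi>J: "\<phi> x \<in> J" if x: "x \<in> J" for x
  proof -
    obtain p where "W x p" using x unfolding J_def by blast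
    then have "W x (SOME p. W x p)" by (rule someI)
    then have "(fst (SOME p. W x p), snd (SOME p. W x p)) \<in> B" by (simp add: W_def)
    then have "fst (SOME p. W x p) \<in> carrier R" by (rule bc)
    then show ?thesis unfolding \<phi>_def using J.I_l_closed[OF x] by simp
  qed
  have \<phi>c: "\<phi> x \<in> carrier R" if "x \<in> J" for x using \<phi>J[OF that] J.a_Hcarr by blast
  have "linear_modulo R J X \<phi>"
    unfolding linear_modulo_def
  proof (intro conjI ballI)
    show "\<phi> \<in> J \<rightarrow> J" using \<phi>J by blast
    fix x y assume x: "x \<in> J" and y: "y \<in> J"
    have xc: "x \<in> carrier R" "y \<in> carrier R" by (rule J.a_Hcarr[OF x], rule J.a_Hcarr[OF y])
    obtain b G where W: "W x (b, G)" "W y (b, G)" using x y common unfolding J_def by blast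
    have b: "b \<in> carrier R" using W(1) bc[of b G] by (simp add: W_def)
    have xy: "x \<oplus> y \<in> J" using x y by simp
    have "\<phi> (x \<oplus> y) \<ominus> (\<phi> x \<oplus> \<phi> y)
        = (\<phi> (x \<oplus> y) \<ominus> b \<otimes> (x \<oplus> y)) \<ominus> ((\<phi> x \<ominus> b \<otimes> x) \<oplus> (\<phi> y \<ominus> b \<otimes> y))"
      using xc b \<phi>c[OF x] \<phi>c[OF y] \<phi>c[OF xy] by algebra
    then show "\<phi> (x \<oplus> y) \<ominus> (\<phi> x \<oplus> \<phi> y) \<in> X"
      using wd[OF x W(1)] wd[OF y W(2)] wd[OF xy W_add[OF W xc]] by (simp add: minus_eq)
  next
    fix a x assume a: "a \<in> carrier R" and x: "x \<in> J"
    have xc: "x \<in> carrier R" using x by (rule J.a_Hcarr)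
    obtain b G where W: "W x (b, G)" using JW[OF x] by blast
    have b: "b \<in> carrier R" using W bc[of b G] by (simp add: W_def)
    have ax: "a \<otimes> x \<in> J" using J.I_l_closed[OF x a] .
    have "\<phi> (a \<otimes> x) \<ominus> a \<otimes> \<phi> x = (\<phi> (a \<otimes> x) \<ominus> b \<otimes> (a \<otimes> x)) \<ominus> a \<otimes> (\<phi> x \<ominus> b \<otimes> x)"
      using a xc b \<phi>c[OF x] \<phi>c[OF ax] by algebra
    then show "\<phi> (a \<otimes> x) \<ominus> a \<otimes> \<phi> x \<in> X"
      using wd[OF ax W_mult[OF W xc a]] X.I_l_closed[OF wd[OF x W] a] by (simp add: minus_eq)
  qed
  then obtain f where f: "linear_modulo R J {\<zero>} f" "\<And>x. x \<in> J \<Longrightarrow> f x \<ominus> \<phi> x \<in> X"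
    using quasi_projective_ideal_module_iff[OF J] qp[OF J] X XJ by blast
  note lin = linear_modulo_zeroD[OF J f(1)]
  have local: "\<exists>r \<in> carrier R. f x = b \<otimes> x \<oplus> r \<otimes> s" if x: "x \<in> J" and W: "W x (b, G)" for x b G
  proof -
    have c: "x \<in> carrier R" "b \<in> carrier R" "f x \<in> carrier R" "\<phi> x \<in> carrier R"
      using J.a_Hcarr[OF x] W bc[of b G] J.a_Hcarr[OF lin(1)[OF x]] \<phi>c[OF x] by (auto simp: W_def)
    have "(f x \<ominus> \<phi> x) \<oplus> (\<phi> x \<ominus> b \<otimes> x) \<in> X" using f(2)[OF x] wd[OF x W] by simp
    then obtain r where r: "r \<in> carrier R" "(f x \<ominus> \<phi> x) \<oplus> (\<phi> x \<ominus> b \<otimes> x) = r \<otimes> s"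
      unfolding X_def cgenideal_def by blast
    have "f x = b \<otimes> x \<oplus> ((f x \<ominus> \<phi> x) \<oplus> (\<phi> x \<ominus> b \<otimes> x))" using c by algebra
    then show ?thesis using r by auto
  qed
  have sJ: "s \<in> J" using sX XJ by blast
  obtain c where c: "c \<in> carrier R" "f s = c \<otimes> s"
  proof -
    obtain b G where W: "W s (b, G)" using JW[OF sJ] by blast
    then have b: "b \<in> carrier R" using bc[of b G] by (simp add: W_def)
    obtain r where "r \<in> carrier R" "f s = b \<otimes> s \<oplus> r \<otimes> s" using local[OF sJ W] by blast
    then show thesis using that[of "b \<oplus> r"] b s by (simp add: l_distr)
  qed
  have "c \<ominus> b \<in> G" if bG: "(b, G) \<in> B" for b G
  proof -
    interpret G: ideal G R by (rule G[OF bG])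
    obtain b' G' where bG': "(b', G') \<in> B" and less: "G' \<subset> G" using strict[OF bG] by auto
    \<comment> \<open>An element of \<open>G\<close> outside a smaller modulus \<open>G'\<close> divides all of \<open>G'\<close>. In particular it
      divides \<open>s\<close>, and the cofactor \<open>v\<close> lies in \<open>J\<close>, with the congruence of \<open>G'\<close> as witness.\<close>
    obtain u where u: "u \<in> G" "u \<notin> G'" using less by blast
    have uc: "u \<in> carrier R" using u(1) by (rule G.a_Hcarr)
    obtain v where v: "v \<in> carrier R" "s = v \<otimes> u"
      using dvd_of_mem_of_notin[OF G[OF bG'] uc u(2) sG[OF bG']] .
    have "v \<otimes> g \<in> X" if g: "g \<in> G'" for g
    proof -
      obtain h where h: "h \<in> carrier R" "g = h \<otimes> u"
        using dvd_of_mem_of_notin[OF G[OF bG'] uc u(2) g] .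
      have "v \<otimes> (h \<otimes> u) = h \<otimes> (v \<otimes> u)" using v h uc by algebra
      then have "v \<otimes> g = h \<otimes> s" using h v by simp
      then show ?thesis using X.I_l_closed[OF sX h(1)] by simp
    qed
    then have W: "W v (b', G')" using bG' by (simp add: W_def)
    then have vJ: "v \<in> J" using v unfolding J_def by blast
    obtain r where r: "r \<in> carrier R" "f v = b' \<otimes> v \<oplus> r \<otimes> s" using local[OF vJ W] by blast
    have b: "b \<in> carrier R" "b' \<in> carrier R" using bc bG bG' by auto
    have "c \<otimes> s = f (u \<otimes> v)" using c v uc by (simp add: m_comm)
    also have "\<dots> = u \<otimes> (b' \<otimes> v \<oplus> r \<otimes> s)" using lin(3)[OF uc vJ] r by simp
    also have "\<dots> = b' \<otimes> (v \<otimes> u) \<oplus> (r \<otimes> u) \<otimes> s" using uc b v(1) r(1) s by algebra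
    also have "\<dots> = (b' \<oplus> r \<otimes> u) \<otimes> s" using v(2)[symmetric] b r(1) uc s by (simp add: l_distr)
    finally have eq: "c \<otimes> s = (b' \<oplus> r \<otimes> u) \<otimes> s" .
    have "s \<otimes> (c \<ominus> (b' \<oplus> r \<otimes> u)) = c \<otimes> s \<ominus> (b' \<oplus> r \<otimes> u) \<otimes> s"
      using s c(1) b r(1) uc by algebra
    also have "\<dots> = \<zero>" using eq s b r(1) uc by (simp add: minus_eq r_neg)
    finally have "c \<ominus> (b' \<oplus> r \<otimes> u) \<in> G"
      using annG[OF bG] c(1) b r(1) uc by simp
    moreover have "r \<otimes> u \<in> G" using G.I_l_closed[OF u(1) r(1)] .
    moreover have "b' \<ominus> b \<in> G" using comp[OF bG' bG] less by blast
    ultimately have "(c \<ominus> (b' \<oplus> r \<otimes> u)) \<oplus> (r \<otimes> u \<oplus> (b' \<ominus> b)) \<in> G" by simp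
    moreover have "c \<ominus> b = (c \<ominus> (b' \<oplus> r \<otimes> u)) \<oplus> (r \<otimes> u \<oplus> (b' \<ominus> b))"
      using c(1) b r(1) uc by algebra
    ultimately show ?thesis by simp
  qed
  then show thesis using that c(1) by blast
qed

text \<open>A smallest modulus makes the system trivial. Otherwise only the moduli inside some \<open>H0\<close> that
  does not contain \<open>t\<close> matter; as \<open>t\<close> divides all of \<open>H0\<close>, these congruences read \<open>x = x0 + t b\<close>, and
  the unknown \<open>x0 + t c\<close> turns them into a system for \<open>c\<close> with the moduli \<open>(H : t)\<close>.\<close>

lemma almost_maximal_of_quasi_projective:
  assumes qp: "\<And>J. ideal J R \<Longrightarrow> quasi_projective R (ideal_module R J)"
  shows "almost_maximal_ring R"
  unfolding almost_maximal_ring_def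
proof (intro allI impI, elim conjE)
  fix A assume A: "ideal A R" "A \<noteq> {\<zero>}"
  show "maximal_ring (R Quot A)"
    unfolding maximal_quotient_iff[OF A(1)]
  proof (intro allI impI)
    fix C assume C: "compatible_congruences R A C"
    note mem = compatible_congruencesD[OF C]
    show "\<exists>y \<in> carrier R. \<forall>(x, H) \<in> C. y \<ominus> x \<in> H"
    proof (cases "C = {} \<or> (\<exists>(x, H) \<in> C. \<forall>(x', H') \<in> C. H \<subseteq> H')")
      case True
      then show ?thesis
      proof (elim disjE bexE)
        fix p assume p: "p \<in> C" "case p of (x, H) \<Rightarrow> \<forall>(x', H') \<in> C. H \<subseteq> H'"
        obtain x H where "p = (x, H)" by (cases p)
        then have xH: "(x, H) \<in> C" "\<And>x' H'. (x', H') \<in> C \<Longrightarrow> H \<subseteq> H'" using p by auto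
        have "\<forall>(x', H') \<in> C. x \<ominus> x' \<in> H'" using mem(4)[OF xH(1)] xH(2) by blast
        then show ?thesis using mem(1)[OF xH(1)] by blast
      qed auto
    next
      case False
      have descend: "\<exists>x' H'. (x', H') \<in> C \<and> H' \<subset> H" if xH: "(x, H) \<in> C" for x H
      proof -
        obtain x' H' where "(x', H') \<in> C" "\<not> H \<subseteq> H'" using False xH by blast
        then show ?thesis using ideals_total[of H H'] mem(2) xH by blast
      qed
      define I where "I = \<Inter> (snd ` C)"
      have "ideal I R" unfolding I_def using False mem(2) by (intro i_Intersect) auto
      moreover have "A \<subseteq> I" unfolding I_def
      proof (rule Inter_greatest)
        fix H assume "H \<in> snd ` C"
        then show "A \<subseteq> H" using mem(3) by (metis imageE prod.collapse)
      qed
      then have "I \<noteq> {\<zero>}"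
        using A additive_subgroup.zero_closed[OF ideal.axioms(1)[OF A(1)]] by blast
      moreover have "I \<noteq> carrier R"
      proof -
        obtain x H where xH: "(x, H) \<in> C" using False by auto
        obtain x' H' where H': "(x', H') \<in> C" "H' \<subset> H" using descend[OF xH] by blast
        have "I \<subseteq> H'" unfolding I_def using H'(1) by force
        moreover have "H \<subseteq> carrier R" using ideal.Icarr[OF mem(2)[OF xH]] by blast
        ultimately show ?thesis using H'(2) by blast
      qed
      ultimately obtain t s where t: "t \<in> carrier R" "t \<notin> I" and s: "s \<in> carrier R"
        and ts: "t \<otimes> s \<in> I" "\<And>x. \<lbrakk>x \<in> carrier R; s \<otimes> x = \<zero>\<rbrakk> \<Longrightarrow> t \<otimes> x \<in> I"
        using exists_element_with_small_annihilator[OF zerodivisors_subset_nilradical[OF qp]] by metis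
      have IH: "I \<subseteq> H" if "(x, H) \<in> C" for x H unfolding I_def using that by force
      obtain x0 H0 where x0: "(x0, H0) \<in> C" "t \<notin> H0" using t(2) unfolding I_def by force
      have x0c: "x0 \<in> carrier R" using mem(1)[OF x0(1)] .
      define C0 where "C0 = {(x, H) \<in> C. H \<subseteq> H0}"
      have C0: "(x, H) \<in> C" "H \<subseteq> H0" if "(x, H) \<in> C0" for x H using that by (auto simp: C0_def)
      have "\<exists>b. b \<in> carrier R \<and> x = x0 \<oplus> t \<otimes> b" if xH: "(x, H) \<in> C0" for x H
      proof -
        have xc: "x \<in> carrier R" using mem(1) C0[OF xH] by blast
        have "x \<ominus> x0 \<in> H0" using mem(4) C0[OF xH] x0(1) by blast
        then obtain b where b: "b \<in> carrier R" "x \<ominus> x0 = b \<otimes> t"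
          using dvd_of_mem_of_notin[OF mem(2)[OF x0(1)] t(1) x0(2)] by blast
        have "x = x0 \<oplus> (x \<ominus> x0)" using xc x0c by algebra
        then show ?thesis using b t(1) by (auto simp: m_comm)
      qed
      then obtain \<beta> where \<beta>: "\<And>x H. (x, H) \<in> C0 \<Longrightarrow> \<beta> x \<in> carrier R"
          "\<And>x H. (x, H) \<in> C0 \<Longrightarrow> x = x0 \<oplus> t \<otimes> \<beta> x"
        by metis
      define col where "col = (\<lambda>H. {x \<in> carrier R. t \<otimes> x \<in> H})"
      have col_mono: "H \<subseteq> H'" if xH: "(x, H) \<in> C0" and sub: "col H \<subseteq> col H'" for x H H'
      proof
        fix h assume h: "h \<in> H"
        then have "h \<in> H0" using C0(2)[OF xH] by blast
        then obtain d where d: "d \<in> carrier R" "h = d \<otimes> t"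
          using dvd_of_mem_of_notin[OF mem(2)[OF x0(1)] t(1) x0(2)] by blast
        then have "h = t \<otimes> d" using t(1) by (simp add: m_comm)
        then have "d \<in> col H" using h d by (simp add: col_def)
        then show "h \<in> H'" using sub \<open>h = t \<otimes> d\<close> by (auto simp: col_def)
      qed
      define B where "B = (\<lambda>(x, H). (\<beta> x, col H)) ` C0"
      have "compatible_congruences R (insert s {x \<in> carrier R. s \<otimes> x = \<zero>}) B"
        unfolding compatible_congruences_def
      proof (clarify, intro conjI)
        fix b G assume "(b, G) \<in> B"
        then obtain x H where xH: "(x, H) \<in> C0" "b = \<beta> x" "G = col H" by (auto simp: B_def)
        show "b \<in> carrier R" using xH \<beta>(1) by simp
        show "ideal G R"
          unfolding xH(3) col_def using colon_ideal[OF mem(2)[OF C0(1)[OF xH(1)]] t(1)] .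
        show "insert s {x \<in> carrier R. s \<otimes> x = \<zero>} \<subseteq> G"
          using IH[OF C0(1)[OF xH(1)]] s ts unfolding xH(3) col_def by blast
        show "\<forall>(b', G') \<in> B. G \<subseteq> G' \<longrightarrow> b \<ominus> b' \<in> G'"
        proof (clarify)
          fix b' G' assume "(b', G') \<in> B" and sub: "G \<subseteq> G'"
          then obtain x' H' where xH': "(x', H') \<in> C0" "b' = \<beta> x'" "G' = col H'" by (auto simp: B_def)
          have "H \<subseteq> H'" using col_mono[OF xH(1)] sub xH xH' by simp
          then have "x \<ominus> x' \<in> H'" using mem(4) C0(1) xH(1) xH'(1) by blast
          moreover have "x \<ominus> x' = t \<otimes> (\<beta> x \<ominus> \<beta> x')"
          proof -
            have "(x0 \<oplus> t \<otimes> \<beta> x) \<ominus> (x0 \<oplus> t \<otimes> \<beta> x') = t \<otimes> (\<beta> x \<ominus> \<beta> x')"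
              using x0c t(1) \<beta>(1)[OF xH(1)] \<beta>(1)[OF xH'(1)] by algebra
            then show ?thesis using \<beta>(2)[OF xH(1)] \<beta>(2)[OF xH'(1)] by simp
          qed
          ultimately show "b \<ominus> b' \<in> G'"
            using \<beta>(1)[OF xH(1)] \<beta>(1)[OF xH'(1)] unfolding xH(2) xH'(2,3) col_def by simp
        qed
      qed
      moreover have "\<exists>(b', G') \<in> B. G' \<subset> G" if bG: "(b, G) \<in> B" for b G
      proof -
        obtain x H where xH: "(x, H) \<in> C0" "b = \<beta> x" "G = col H" using bG by (auto simp: B_def)
        obtain x' H' where H': "(x', H') \<in> C" "H' \<subset> H" using descend[OF C0(1)[OF xH(1)]] by blast
        then have H'0: "(x', H') \<in> C0" using C0(2)[OF xH(1)] by (auto simp: C0_def)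
        have "col H' \<subseteq> col H" using H'(2) by (auto simp: col_def)
        moreover have "\<not> col H \<subseteq> col H'" using col_mono[OF xH(1)] H'(2) by blast
        ultimately have "col H' \<subset> G" using xH(3) by blast
        moreover have "(\<beta> x', col H') \<in> B" using H'0 by (force simp: B_def)
        ultimately show ?thesis by blast
      qed
      ultimately obtain c where c: "c \<in> carrier R" "\<And>b G. (b, G) \<in> B \<Longrightarrow> c \<ominus> b \<in> G"
        using solvable_of_quasi_projective[OF qp s] by blast
      have in_C0: "(x0 \<oplus> t \<otimes> c) \<ominus> x \<in> H" if xH: "(x, H) \<in> C0" for x H
      proof -
        have "(\<beta> x, col H) \<in> B" using xH by (force simp: B_def)
        then have "t \<otimes> (c \<ominus> \<beta> x) \<in> H" using c(2) by (auto simp: col_def)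
        moreover have "(x0 \<oplus> t \<otimes> c) \<ominus> (x0 \<oplus> t \<otimes> \<beta> x) = t \<otimes> (c \<ominus> \<beta> x)"
          using x0c t(1) c(1) \<beta>(1)[OF xH] by algebra
        ultimately show ?thesis using \<beta>(2)[OF xH] by simp
      qed
      have "(x0 \<oplus> t \<otimes> c) \<ominus> x \<in> H" if xH: "(x, H) \<in> C" for x H
      proof (cases "H \<subseteq> H0")
        case True
        then show ?thesis using in_C0 xH by (simp add: C0_def)
      next
        case False
        then have sub: "H0 \<subseteq> H" using ideals_total mem(2) xH x0(1) by blast
        have "(x0 \<oplus> t \<otimes> c) \<ominus> x0 \<in> H" using in_C0[of x0 H0] x0(1) sub by (auto simp: C0_def)
        moreover have "x0 \<ominus> x \<in> H" using mem(4)[OF x0(1) xH sub] .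
        moreover have "x0 \<oplus> t \<otimes> c \<in> carrier R" using x0c t(1) c(1) by simp
        ultimately show ?thesis
          using minus_mem_ideal_trans[OF mem(2)[OF xH] _ x0c mem(1)[OF xH]] by blast
      qed
      then show ?thesis using x0c t(1) c(1) by (intro bexI[of _ "x0 \<oplus> t \<otimes> c"]) auto
    qed
  qed
qed

end

section \<open>Quasi-projective ideals from almost maximality\<close>

context chain_ring
begin

text \<open>The congruences \<open>c \<equiv> b\<^sub>x\<close> modulo \<open>(X : x)\<close> say that \<open>c x\<close> represents the same class as \<open>g x\<close>. They are
  compatible because, of any two elements of \<open>J\<close>, one is a multiple of the other.\<close>

lemma linear_lift_of_locally_scalar:
  assumes X: "ideal X R" and J: "ideal J R" "X \<subseteq> J" and g: "linear_modulo R J X g"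
    and max: "maximal_ring (R Quot X)"
    and scal: "\<And>x. x \<in> J \<Longrightarrow> \<exists>b \<in> carrier R. g x \<ominus> b \<otimes> x \<in> X"
  obtains f where "linear_modulo R J {\<zero>} f" "\<And>x. x \<in> J \<Longrightarrow> f x \<ominus> g x \<in> X"
proof -
  interpret X: ideal X R by (rule X)
  interpret J: ideal J R by (rule J)
  have gc: "g x \<in> J" "g x \<in> carrier R" if "x \<in> J" for x
    using g that J.a_Hcarr unfolding linear_modulo_def by (metis Pi_mem)+
  have xc: "x \<in> carrier R" if "x \<in> J" for x using that J.a_Hcarr by blast
  obtain b where b: "\<And>x. x \<in> J \<Longrightarrow> b x \<in> carrier R"
      "\<And>x. x \<in> J \<Longrightarrow> g x \<ominus> b x \<otimes> x \<in> X"
    using scal by metis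
  define D where "D = (\<lambda>x. {r \<in> carrier R. x \<otimes> r \<in> X})"
  have step: "(k \<otimes> x) \<otimes> (b x \<ominus> b (k \<otimes> x)) \<in> X"
    if x: "x \<in> J" and k: "k \<in> carrier R" for x k
  proof -
    have kx: "k \<otimes> x \<in> J" using J.I_l_closed k x by simp
    have 1: "g (k \<otimes> x) \<ominus> k \<otimes> g x \<in> X" using g k x by (simp add: linear_modulo_def)
    have 2: "k \<otimes> (g x \<ominus> b x \<otimes> x) \<in> X" using b(2)[OF x] k X.I_l_closed by simp
    have 3: "g (k \<otimes> x) \<ominus> b (k \<otimes> x) \<otimes> (k \<otimes> x) \<in> X" using b(2)[OF kx] .
    have "(k \<otimes> x) \<otimes> (b x \<ominus> b (k \<otimes> x)) = (g (k \<otimes> x) \<ominus> b (k \<otimes> x) \<otimes> (k \<otimes> x))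
        \<ominus> ((g (k \<otimes> x) \<ominus> k \<otimes> g x) \<oplus> k \<otimes> (g x \<ominus> b x \<otimes> x))"
      using xc[OF x] k b(1)[OF x] b(1)[OF kx] gc(2)[OF x] gc(2)[OF kx] by algebra
    then show ?thesis using 1 2 3 by (simp add: minus_eq)
  qed
  have compat: "b x \<ominus> b y \<in> D y" if x: "x \<in> J" and y: "y \<in> J" and sub: "D x \<subseteq> D y" for x y
    using dvd_total[OF xc[OF x] xc[OF y]]
  proof (elim disjE bexE)
    fix k assume k: "k \<in> carrier R" "x = k \<otimes> y"
    have "x \<otimes> (b y \<ominus> b x) \<in> X" using step[OF y k(1)] k by simp
    then have "\<ominus> (x \<otimes> (b y \<ominus> b x)) \<in> X" by simp
    moreover have "x \<otimes> (b x \<ominus> b y) = \<ominus> (x \<otimes> (b y \<ominus> b x))"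
      using xc[OF x] b(1)[OF x] b(1)[OF y] by algebra
    ultimately have "b x \<ominus> b y \<in> D x" using b(1)[OF x] b(1)[OF y] by (simp add: D_def)
    then show ?thesis using sub by blast
  next
    fix k assume k: "k \<in> carrier R" "y = k \<otimes> x"
    then show ?thesis using step[OF x k(1)] b(1)[OF x] b(1)[OF y] by (simp add: D_def)
  qed
  have "compatible_congruences R X ((\<lambda>x. (b x, D x)) ` J)"
  proof -
    have "ideal (D x) R" "X \<subseteq> D x" if "x \<in> J" for x
      unfolding D_def using colon_ideal[OF X xc[OF that]] X.I_l_closed X.a_Hcarr xc[OF that] by auto
    then show ?thesis using compat b(1) by (auto simp: compatible_congruences_def)
  qed
  then have "\<exists>c \<in> carrier R. \<forall>(x, H) \<in> (\<lambda>x. (b x, D x)) ` J. c \<ominus> x \<in> H"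
    using max maximal_quotient_iff[OF X] by metis
  then obtain c where c: "c \<in> carrier R" "\<And>x. x \<in> J \<Longrightarrow> c \<ominus> b x \<in> D x"
    by auto
  have "linear_modulo R J {\<zero>} (\<lambda>x. c \<otimes> x)"
    unfolding linear_modulo_def
  proof (intro conjI ballI)
    show "(\<lambda>x. c \<otimes> x) \<in> J \<rightarrow> J" using c J.I_l_closed by auto
    show "c \<otimes> (x \<oplus> y) \<ominus> (c \<otimes> x \<oplus> c \<otimes> y) \<in> {\<zero>}" if "x \<in> J" "y \<in> J" for x y
      using minus_eq_zero_iff[of "c \<otimes> (x \<oplus> y)" "c \<otimes> x \<oplus> c \<otimes> y"] that c xc by (simp add: r_distr)
    show "c \<otimes> (a \<otimes> x) \<ominus> a \<otimes> (c \<otimes> x) \<in> {\<zero>}" if "a \<in> carrier R" "x \<in> J" for a x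
      using minus_eq_zero_iff[of "c \<otimes> (a \<otimes> x)" "a \<otimes> (c \<otimes> x)"] that c xc by (simp add: m_lcomm)
  qed
  moreover have "c \<otimes> x \<ominus> g x \<in> X" if x: "x \<in> J" for x
  proof -
    have "c \<otimes> x \<ominus> g x = x \<otimes> (c \<ominus> b x) \<ominus> (g x \<ominus> b x \<otimes> x)"
      using c(1) xc[OF x] b(1)[OF x] gc[OF x] by algebra
    then show ?thesis using c(2)[OF x] b(2)[OF x] by (simp add: D_def minus_eq)
  qed
  ultimately show thesis using that by blast
qed

text \<open>Morally \<open>g\<close> multiplies by \<open>1/r\<close> at \<open>s\<close>; the conclusion is that it multiplies by \<open>1/r\<close>, up to a
  unit, at every divisor \<open>x\<close> of \<open>s\<close> in \<open>J\<close> as well. Indeed \<open>g x\<close> cannot be a multiple of \<open>x\<close>, since then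
  \<open>g s\<close> would be a multiple of \<open>s\<close> modulo \<open>X\<close>. So \<open>x = q g(x)\<close>, and comparing the two expressions for \<open>s\<close>
  shows that \<open>q\<close> and \<open>r\<close> agree up to a unit modulo the annihilator of \<open>g s\<close>. That annihilator does not
  contain \<open>r\<close>, so \<open>q\<close> and \<open>r\<close> are associates.\<close>

lemma nonscalar_value_divides:
  assumes X: "ideal X R" and J: "ideal J R" and g: "linear_modulo R J X g"
    and r: "r \<in> carrier R" and s: "s = r \<otimes> g s" "s \<in> J" "s \<noteq> \<zero>"
    and nonscal: "\<And>b. b \<in> carrier R \<Longrightarrow> g s \<ominus> b \<otimes> s \<notin> X"
    and x: "x \<in> J" and k: "k \<in> carrier R" "s = k \<otimes> x"
  obtains v v' where "v \<in> carrier R" "v' \<in> carrier R" "v \<otimes> v' = \<one>" "x = (v \<otimes> r) \<otimes> g x"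
proof -
  interpret X: ideal X R by (rule X)
  interpret J: ideal J R by (rule J)
  have gc: "g x \<in> carrier R" if "x \<in> J" for x
    using g that J.a_Hcarr unfolding linear_modulo_def by (metis Pi_mem)
  define y where "y = g s"
  define z where "z = g x"
  have yc: "y \<in> carrier R" and zc: "z \<in> carrier R" and xc: "x \<in> carrier R" and sc: "s \<in> carrier R"
    using gc s x J.a_Hcarr by (auto simp: y_def z_def)
  have yX: "y \<notin> X" using nonscal[OF zero_closed] sc yc by (simp add: y_def minus_eq)
  have ykz: "y \<ominus> k \<otimes> z \<in> X"
    using g k x unfolding linear_modulo_def y_def z_def by blast
  then have kzy: "k \<otimes> z \<ominus> y \<in> X" using minus_mem_ideal_swap[OF X yc] k zc by simp
  have "\<not> (\<exists>b \<in> carrier R. z = b \<otimes> x)"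
  proof
    assume "\<exists>b \<in> carrier R. z = b \<otimes> x"
    then obtain b where b: "b \<in> carrier R" "z = b \<otimes> x" by blast
    then have "k \<otimes> z = b \<otimes> s" using k xc by (simp add: m_lcomm)
    then show False using ykz nonscal[OF b(1)] by (simp add: y_def)
  qed
  then obtain q where q: "q \<in> carrier R" "x = q \<otimes> z" using dvd_total[OF zc xc] by blast
  obtain e e' where e: "e \<in> carrier R" "e' \<in> carrier R" "e \<otimes> e' = \<one>" "k \<otimes> z = e \<otimes> y"
    using associate_of_congruent[OF X yc yX _ kzy] k zc by blast
  have "s = q \<otimes> (k \<otimes> z)" using k q zc by (simp add: m_lcomm)
  then have s2: "s = q \<otimes> (e \<otimes> y)" using e(4) by simp
  \<comment> \<open>Comparing \<open>s = q e y\<close> with \<open>s = r y\<close> identifies \<open>q e\<close> and \<open>r\<close> modulo the annihilator of \<open>y\<close>.\<close>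
  define Y where "Y = {a \<in> carrier R. y \<otimes> a = \<zero>}"
  have Y: "ideal Y R" unfolding Y_def by (rule annihilator_ideal[OF yc])
  have "r \<notin> Y" using s(1,3) r yc unfolding Y_def y_def[symmetric] by (auto simp: m_comm)
  moreover have "q \<otimes> e \<ominus> r \<in> Y"
  proof -
    have "y \<otimes> (q \<otimes> e \<ominus> r) = q \<otimes> (e \<otimes> y) \<ominus> r \<otimes> y" using yc q(1) e(1) r by algebra
    also have "\<dots> = s \<ominus> s" using s2 s(1) by (simp add: y_def)
    also have "\<dots> = \<zero>" using sc by (simp add: minus_eq r_neg)
    finally show ?thesis using q e r by (simp add: Y_def)
  qed
  ultimately obtain w w' where w: "w \<in> carrier R" "w' \<in> carrier R" "w \<otimes> w' = \<one>" "q \<otimes> e = w \<otimes> r"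
    using associate_of_congruent[OF Y r, of "q \<otimes> e"] q(1) e(1) by auto
  have "q = q \<otimes> (e \<otimes> e')" using q e by simp
  also have "\<dots> = e' \<otimes> (q \<otimes> e)" using q(1) e(1,2) by algebra
  also have "\<dots> = (e' \<otimes> w) \<otimes> r" using e(2) w(1,4) r by (simp add: m_assoc)
  finally have "x = ((e' \<otimes> w) \<otimes> r) \<otimes> g x" using q(2) by (simp add: z_def)
  moreover have "(e' \<otimes> w) \<otimes> (w' \<otimes> e) = \<one>"
  proof -
    have "(e' \<otimes> w) \<otimes> (w' \<otimes> e) = (e \<otimes> e') \<otimes> (w \<otimes> w')" using e(1,2) w(1,2) by algebra
    then show ?thesis using e(3) w(3) by simp
  qed
  ultimately show thesis using that[of "e' \<otimes> w" "w' \<otimes> e"] e w by simp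
qed

text \<open>When \<open>g\<close> is not locally scalar, the witness \<open>r\<close> satisfies \<open>J = r J\<close>, hence \<open>s \<in> r\<^sup>n J\<close> for all \<open>n\<close>.
  As \<open>s \<noteq> 0\<close>, this keeps \<open>r\<close> from being nilpotent, and the hypothesis on zerodivisors makes it
  regular. So \<open>J\<close> can be divided by \<open>r\<close>, which reduces \<open>g\<close> to the locally scalar map \<open>r g\<close>.\<close>

lemma quasi_projective_of_almost_maximal:
  assumes max: "almost_maximal_ring R" and Z: "zerodivisors R \<subseteq> nilradical R"
    and J: "ideal J R"
  shows "quasi_projective R (ideal_module R J)"
  unfolding quasi_projective_ideal_module_iff[OF J]
proof (intro allI impI, elim conjE)
  fix X g assume X: "ideal X R" and XJ: "X \<subseteq> J" and g: "linear_modulo R J X g"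
  interpret X: ideal X R by (rule X)
  interpret J: ideal J R by (rule J)
  have gJ: "g x \<in> J" and gc: "g x \<in> carrier R" if "x \<in> J" for x
    using g that J.a_Hcarr unfolding linear_modulo_def by (metis Pi_mem)+
  have g_add: "g (x \<oplus> y) \<ominus> (g x \<oplus> g y) \<in> X" if "x \<in> J" "y \<in> J" for x y
    using g that by (simp add: linear_modulo_def)
  have g_mult: "g (a \<otimes> x) \<ominus> a \<otimes> g x \<in> X" if "a \<in> carrier R" "x \<in> J" for a x
    using g that by (simp add: linear_modulo_def)
  have xc: "x \<in> carrier R" if "x \<in> J" for x using that J.a_Hcarr by blast
  show "\<exists>f. linear_modulo R J {\<zero>} f \<and> (\<forall>x \<in> J. f x \<ominus> g x \<in> X)"
  proof (cases "X = {\<zero>}")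
    case True
    then show ?thesis using g gc by (intro exI[of _ g]) (simp add: minus_eq r_neg)
  next
    case False
    then have maxX: "maximal_ring (R Quot X)" using max X by (simp add: almost_maximal_ring_def)
    show ?thesis
    proof (cases "\<forall>x \<in> J. \<exists>b \<in> carrier R. g x \<ominus> b \<otimes> x \<in> X")
      case True
      then show ?thesis using linear_lift_of_locally_scalar[OF X J XJ g maxX] by metis
    next
      case False
      then obtain s where sJ: "s \<in> J" and nonscal: "\<And>b. b \<in> carrier R \<Longrightarrow> g s \<ominus> b \<otimes> s \<notin> X" by blast
      have "\<not> (\<exists>b \<in> carrier R. g s = b \<otimes> s)"
        using nonscal xc[OF sJ] X.zero_closed minus_eq_zero_iff by (metis m_closed)
      then obtain r where r: "r \<in> carrier R" "s = r \<otimes> g s"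
        using dvd_total[OF gc[OF sJ] xc[OF sJ]] by blast
      have s0: "s \<noteq> \<zero>"
      proof
        assume s: "s = \<zero>"
        have "g (\<zero> \<otimes> s) \<ominus> \<zero> \<otimes> g s \<in> X" using g_mult[OF zero_closed sJ] .
        then show False using nonscal[OF zero_closed] gc[OF sJ] s by simp
      qed
      have up: "\<exists>v v'. v \<in> carrier R \<and> v' \<in> carrier R \<and> v \<otimes> v' = \<one> \<and> x = (v \<otimes> r) \<otimes> g x"
        if "x \<in> J" "k \<in> carrier R" "s = k \<otimes> x" for x k
        using nonscalar_value_divides[OF X J g r sJ s0 nonscal that] by blast
      have div: "\<exists>x'. x' \<in> J \<and> x = r \<otimes> x'" if x: "x \<in> J" for x
        using dvd_total[OF xc[OF x] xc[OF sJ]]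
      proof (elim disjE bexE)
        fix k assume k: "k \<in> carrier R" "x = k \<otimes> s"
        have "k \<otimes> (r \<otimes> g s) = r \<otimes> (k \<otimes> g s)" using k r gc[OF sJ] by (simp add: m_lcomm)
        then have "x = r \<otimes> (k \<otimes> g s)" using k r by simp
        then show ?thesis using J.I_l_closed[OF gJ[OF sJ] k(1)] by blast
      next
        fix k assume k: "k \<in> carrier R" "s = k \<otimes> x"
        obtain v where v: "v \<in> carrier R" "x = (v \<otimes> r) \<otimes> g x" using up[OF x k] by blast
        have "(v \<otimes> r) \<otimes> g x = r \<otimes> (v \<otimes> g x)" using v(1) r(1) gc[OF x] by algebra
        then have "x = r \<otimes> (v \<otimes> g x)" using v(2) by simp
        then show ?thesis using J.I_l_closed[OF gJ[OF x] v(1)] by blast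
      qed
      have scal: "\<exists>b \<in> carrier R. r \<otimes> g x \<ominus> b \<otimes> x \<in> X" if x: "x \<in> J" for x
        using dvd_total[OF xc[OF x] xc[OF sJ]]
      proof (elim disjE bexE)
        fix k assume k: "k \<in> carrier R" "x = k \<otimes> s"
        have "r \<otimes> (g x \<ominus> k \<otimes> g s) \<in> X"
          using X.I_l_closed[OF g_mult[OF k(1) sJ] r(1)] k(2) by simp
        moreover have "r \<otimes> (g x \<ominus> k \<otimes> g s) = r \<otimes> g x \<ominus> k \<otimes> (r \<otimes> g s)"
          using r(1) k(1) gc[OF x] gc[OF sJ] by algebra
        moreover have "k \<otimes> (r \<otimes> g s) = \<one> \<otimes> x" using k r(2) xc[OF x] by simp
        ultimately show ?thesis by (metis one_closed)
      next
        fix k assume k: "k \<in> carrier R" "s = k \<otimes> x"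
        obtain v v' where v: "v \<in> carrier R" "v' \<in> carrier R" "v \<otimes> v' = \<one>" "x = (v \<otimes> r) \<otimes> g x"
          using up[OF x k] by blast
        have "v' \<otimes> x = v' \<otimes> ((v \<otimes> r) \<otimes> g x)" using v(4) by simp
        also have "\<dots> = (v \<otimes> v') \<otimes> (r \<otimes> g x)" using v(1,2) r(1) gc[OF x] by algebra
        also have "\<dots> = r \<otimes> g x" using v(3) r(1) gc[OF x] by simp
        finally have "r \<otimes> g x \<ominus> v' \<otimes> x = \<zero>"
          using minus_eq_zero_iff r(1) gc[OF x] by simp
        then show ?thesis using v(2) X.zero_closed by metis
      qed
      have pow: "\<exists>x \<in> J. s = r [^] n \<otimes> x" for n :: nat
      proof (induction n)
        case 0
        then show ?case using sJ xc by (intro bexI[of _ s]) simp_all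
      next
        case (Suc n)
        then obtain x where x: "x \<in> J" "s = r [^] n \<otimes> x" by blast
        obtain x' where x': "x' \<in> J" "x = r \<otimes> x'" using div[OF x(1)] by blast
        have "s = r [^] Suc n \<otimes> x'" using x(2) x' r(1) xc[OF x'(1)] by (simp add: m_assoc)
        then show ?case using x'(1) by blast
      qed
      have "r \<notin> nilradical R"
      proof
        assume "r \<in> nilradical R"
        then obtain n :: nat where n: "r [^] n = \<zero>" by (auto simp: nilradical_def)
        obtain x where "x \<in> J" "s = r [^] n \<otimes> x" using pow by blast
        then show False using s0 n xc by simp
      qed
      then have reg: "x = \<zero>" if "x \<in> carrier R" "r \<otimes> x = \<zero>" for x
        using Z r(1) that unfolding zerodivisors_def by blast
      have cancel: "x = x'" if "x \<in> J" "x' \<in> J" "r \<otimes> x = r \<otimes> x'" for x x'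
      proof -
        have "r \<otimes> (x \<ominus> x') = r \<otimes> x \<ominus> r \<otimes> x'" using xc[OF that(1)] xc[OF that(2)] r(1) by algebra
        also have "\<dots> = \<zero>" using that xc r(1) by (simp add: minus_eq r_neg)
        finally show ?thesis using reg[of "x \<ominus> x'"] minus_eq_zero_iff xc that by simp
      qed
      have "linear_modulo R J X (\<lambda>x. r \<otimes> g x)"
        unfolding linear_modulo_def
      proof (intro conjI ballI)
        show "(\<lambda>x. r \<otimes> g x) \<in> J \<rightarrow> J" using gJ J.I_l_closed r(1) by blast
        fix x y assume x: "x \<in> J" and y: "y \<in> J"
        have xy: "x \<oplus> y \<in> J" using x y by simp
        have "r \<otimes> g (x \<oplus> y) \<ominus> (r \<otimes> g x \<oplus> r \<otimes> g y) = r \<otimes> (g (x \<oplus> y) \<ominus> (g x \<oplus> g y))"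
          using r(1) gc[OF x] gc[OF y] gc[OF xy] by algebra
        then show "r \<otimes> g (x \<oplus> y) \<ominus> (r \<otimes> g x \<oplus> r \<otimes> g y) \<in> X"
          using X.I_l_closed[OF g_add[OF x y] r(1)] by simp
      next
        fix a x assume a: "a \<in> carrier R" and x: "x \<in> J"
        have ax: "a \<otimes> x \<in> J" using J.I_l_closed[OF x a] .
        have "r \<otimes> g (a \<otimes> x) \<ominus> a \<otimes> (r \<otimes> g x) = r \<otimes> (g (a \<otimes> x) \<ominus> a \<otimes> g x)"
          using r(1) a gc[OF x] gc[OF ax] by algebra
        then show "r \<otimes> g (a \<otimes> x) \<ominus> a \<otimes> (r \<otimes> g x) \<in> X"
          using X.I_l_closed[OF g_mult[OF a x] r(1)] by simp
      qed
      then obtain f where f: "linear_modulo R J {\<zero>} f" "\<And>x. x \<in> J \<Longrightarrow> f x \<ominus> r \<otimes> g x \<in> X"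
        using linear_lift_of_locally_scalar[OF X J XJ _ maxX scal] by blast
      note lin = linear_modulo_zeroD[OF J f(1)]
      have "\<forall>x \<in> J. \<exists>x'. x' \<in> J \<and> x = r \<otimes> x'" using div by blast
      from bchoice[OF this] obtain h where h: "\<And>x. x \<in> J \<Longrightarrow> h x \<in> J" "\<And>x. x \<in> J \<Longrightarrow> r \<otimes> h x = x"
        by metis
      have h_add: "h (x \<oplus> y) = h x \<oplus> h y" if x: "x \<in> J" and y: "y \<in> J" for x y
      proof (rule cancel)
        show "r \<otimes> h (x \<oplus> y) = r \<otimes> (h x \<oplus> h y)"
          using h x y r(1) xc by (simp add: r_distr)
      qed (use h x y in auto)
      have h_mult: "h (a \<otimes> x) = a \<otimes> h x" if a: "a \<in> carrier R" and x: "x \<in> J" for a x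
      proof (rule cancel)
        have ax: "a \<otimes> x \<in> J" using J.I_l_closed[OF x a] .
        then show "h (a \<otimes> x) \<in> J" by (rule h)
        show "a \<otimes> h x \<in> J" using J.I_l_closed[OF h(1)[OF x] a] .
        have "r \<otimes> (a \<otimes> h x) = a \<otimes> (r \<otimes> h x)" using r(1) a xc[OF h(1)[OF x]] by (simp add: m_lcomm)
        then show "r \<otimes> h (a \<otimes> x) = r \<otimes> (a \<otimes> h x)" using h(2)[OF ax] h(2)[OF x] by simp
      qed
      have fhc: "f (h x) \<in> carrier R" if "x \<in> J" for x using xc[OF lin(1)[OF h(1)[OF that]]] .
      have "linear_modulo R J {\<zero>} (\<lambda>x. f (h x))"
        unfolding linear_modulo_def
      proof (intro conjI ballI)
        show "(\<lambda>x. f (h x)) \<in> J \<rightarrow> J" using lin(1) h(1) by blast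
        show "f (h (x \<oplus> y)) \<ominus> (f (h x) \<oplus> f (h y)) \<in> {\<zero>}" if x: "x \<in> J" and y: "y \<in> J" for x y
        proof -
          have "f (h (x \<oplus> y)) = f (h x) \<oplus> f (h y)"
            using h_add[OF x y] lin(2)[OF h(1)[OF x] h(1)[OF y]] by simp
          then show ?thesis using fhc[OF x] fhc[OF y] by (simp add: minus_eq r_neg)
        qed
        show "f (h (a \<otimes> x)) \<ominus> a \<otimes> f (h x) \<in> {\<zero>}" if a: "a \<in> carrier R" and x: "x \<in> J" for a x
        proof -
          have "f (h (a \<otimes> x)) = a \<otimes> f (h x)"
            using h_mult[OF a x] lin(3)[OF a h(1)[OF x]] by simp
          then show ?thesis using fhc[OF x] a by (simp add: minus_eq r_neg)
        qed
      qed
      moreover have "f (h x) \<ominus> g x \<in> X" if x: "x \<in> J" for x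
      proof -
        have 1: "f (h x) \<ominus> r \<otimes> g (h x) \<in> X" using f(2)[OF h(1)[OF x]] .
        have 2: "g x \<ominus> r \<otimes> g (h x) \<in> X" using g_mult[OF r(1) h(1)[OF x]] h(2)[OF x] by simp
        have c: "r \<otimes> g (h x) \<in> carrier R" using r(1) gc[OF h(1)[OF x]] by simp
        show ?thesis
          using minus_mem_ideal_trans[OF X fhc[OF x] c gc[OF x] 1
              minus_mem_ideal_swap[OF X gc[OF x] c 2]] .
      qed
      ultimately show ?thesis by blast
    qed
  qed
qed

end

section \<open>The equivalence\<close>

theorem theorem3p1:
  fixes R (structure)
  assumes "chain_ring R"
  shows "(almost_maximal_ring R \<and> zerodivisors R = nilradical R)
           \<longleftrightarrow> (\<forall>I. ideal I R \<longrightarrow> quasi_projective R (ideal_module R I))"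
proof -
  interpret chain_ring R by (rule assms)
  show ?thesis
  proof
    assume "almost_maximal_ring R \<and> zerodivisors R = nilradical R"
    then show "\<forall>I. ideal I R \<longrightarrow> quasi_projective R (ideal_module R I)"
      using quasi_projective_of_almost_maximal by simp
  next
    assume "\<forall>I. ideal I R \<longrightarrow> quasi_projective R (ideal_module R I)"
    then have qp: "\<And>J. ideal J R \<Longrightarrow> quasi_projective R (ideal_module R J)" by blast
    show "almost_maximal_ring R \<and> zerodivisors R = nilradical R"
      using almost_maximal_of_quasi_projective[OF qp] zerodivisors_subset_nilradical[OF qp]
        nilradical_subset_zerodivisors by auto
  qed
qed

end
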